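(* Consider a refracting piecewise-$C^3$ system $\dot{x} = f^L(x)$ for $H(x)<0$, $\dot{x} = f^R(x)$ for $H(x)>0$, on an open set $\Omega \subset \mathbb{R}^n$, with discontinuity surface $\Sigma$ and tangency surface $\mathcal{T}$, and let $S \subset \mathcal{T}$ be a compact invisible-invisible region. There exists a neighbourhood $\mathcal{N} \subset \Omega$ of $S$ such that $P = P_L \circ P_R$ is well-defined for all $x \in \mathcal{N} \cap \Sigma$ with $V(x) = \nu > 0$, and $$\tau(x) = 2 \left( \frac{1}{\mathcal{L}_{f^L}^2 H(x)} - \frac{1}{\mathcal{L}_{f^R}^2 H(x)} \right) \nu + \mathcal{O}(\nu^2),$$ $$P(x) = x + 2 \left( \frac{f^L(x)}{\mathcal{L}_{f^L}^2 H(x)} - \frac{f^R(x)}{\mathcal{L}_{f^R}^2 H(x)} \right) \nu + \mathcal{O}(\nu^2),$$ $$V(P(x)) = \nu + \frac{2 \Lambda(x) \nu^2}{3} + \mathcal{O}(\nu^3),$$ where $$\Lambda = \frac{\mathcal{L}_{f^L}^3 H}{\left( \mathcal{L}_{f^L}^2 H \right)^2} - \frac{\mathcal{L}_{f^R}^3 H}{\left( \mathcal{L}_{f^R}^2 H \right)^2}.$$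
   Context: Let $\Omega \subset \mathbb{R}^n$ be open. The system $\dot{x} = f^L(x)$ if $H(x)<0$, $\dot{x}=f^R(x)$ if $H(x)>0$ is piecewise-$C^k$ if $f^L, f^R : \Omega \to \mathbb{R}^n$ are $C^k$ and $H : \Omega \to \mathbb{R}$ is $C^{k+1}$ with $\nabla H(x) \ne 0$ for all $x \in \Sigma$, where $\Sigma = \{ x \in \Omega : H(x) = 0 \}$. Lie derivatives: $\mathcal{L}_f^0 h = h$ and $\mathcal{L}_f^m h(x) = (\nabla \mathcal{L}_f^{m-1} h(x))^{\sf T} f(x)$ for $m \ge 1$; $\mathcal{L}_f h = \mathcal{L}_f^1 h$. The system is refracting if $\mathcal{L}_{f^L} H(x) = \mathcal{L}_{f^R} H(x)$ for all $x \in \Sigma$. Write $V(x) = \mathcal{L}_{f^L} H(x)$ for $x \in \Omega$ (so $V = \mathcal{L}_{f^L}H = \mathcal{L}_{f^R} H$ on $\Sigma$), and $\mathcal{T} = \{ x \in \Sigma : V(x) = 0 \}$. A subset $S \subset \mathcal{T}$ is an invisible-invisible region if $\mathcal{L}_{f^L}^2 H(x) > 0$ and $\mathcal{L}_{f^R}^2 H(x) < 0$ for all $x \in S$. Return maps: for $x \in \Sigma$ with $V(x) > 0$, $P_R(x)$ is the next point in the forward orbit of $x$ under $\dot{x} = f^R(x)$ that belongs to $\Sigma$ (assuming this orbit returns to $\Sigma$), and $\tau_R(x)$ is the corresponding evolution time. For $x \in \Sigma$ with $V(x)<0$, $P_L(x)$ is the next point in the forward orbit of $x$ under $\dot{x}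 = f^L(x)$ that belongs to $\Sigma$ (assuming this orbit returns to $\Sigma$), and $\tau_L(x)$ is the corresponding evolution time. Then $P = P_L \circ P_R$ and $\tau = \tau_L \circ P_R + \tau_R$. The notation $\mathcal{O}(\nu^m)$ denotes a quantity bounded in norm by $C\nu^m$ with a constant $C$ independent of $x \in \mathcal{N} \cap \Sigma$ with $V(x)=\nu>0$. *)

theory Defs
  imports "HOL-Analysis.Analysis"
begin

text \<open>All functions are total; for an open domain only their values on that domain matter,
  because derivatives are local.\<close>

primrec Ck_on :: "nat \<Rightarrow> ('a::real_normed_vector \<Rightarrow> 'b::real_normed_vector) \<Rightarrow> 'a set \<Rightarrow> bool" where
  "Ck_on 0 f S \<longleftrightarrow> continuous_on S f"
| "Ck_on (Suc k) f S \<longleftrightarrow> (\<forall>x\<in>S. f differentiable (at x)) \<and>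
     (\<forall>v. Ck_on k (\<lambda>x. frechet_derivative f (at x) v) S)"

text \<open>Directional derivatives in all directions include the partial derivatives, so this is the
  usual notion of class \<open>C\<^sup>k\<close> on an open subset of a Euclidean space.\<close>

definition grad :: "('a::real_inner \<Rightarrow> real) \<Rightarrow> 'a \<Rightarrow> 'a" where
  "grad h x = (THE D. GDERIV h x :> D)"

primrec lie :: "('a::real_inner \<Rightarrow> 'a) \<Rightarrow> nat \<Rightarrow> ('a \<Rightarrow> real) \<Rightarrow> 'a \<Rightarrow> real" where
  "lie f 0 h = h"
| "lie f (Suc m) h = (\<lambda>x. grad (lie f m h) x \<bullet> f x)"

definition disc_surface :: "'a set \<Rightarrow> ('a \<Rightarrow> real) \<Rightarrow> 'a set" where
  "disc_surface \<Omega> H = {x \<in> \<Omega>. H x = 0}"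

definition piecewise_Ck ::
  "nat \<Rightarrow> ('a::real_inner) set \<Rightarrow> ('a \<Rightarrow> 'a) \<Rightarrow> ('a \<Rightarrow> 'a) \<Rightarrow> ('a \<Rightarrow> real) \<Rightarrow> bool" where
  "piecewise_Ck k \<Omega> fL fR H \<longleftrightarrow>
     open \<Omega> \<and> Ck_on k fL \<Omega> \<and> Ck_on k fR \<Omega> \<and> Ck_on (Suc k) H \<Omega> \<and>
     (\<forall>x \<in> disc_surface \<Omega> H. grad H x \<noteq> 0)"

definition refracting ::
  "('a::real_inner) set \<Rightarrow> ('a \<Rightarrow> 'a) \<Rightarrow> ('a \<Rightarrow> 'a) \<Rightarrow> ('a \<Rightarrow> real) \<Rightarrow> bool" where
  "refracting \<Omega> fL fR H \<longleftrightarrow> (\<forall>x \<in> disc_surface \<Omega> H. lie fL 1 H x = lie fR 1 H x)"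

definition vel :: "('a::real_inner \<Rightarrow> 'a) \<Rightarrow> ('a \<Rightarrow> real) \<Rightarrow> 'a \<Rightarrow> real" where
  "vel fL H x = lie fL 1 H x"

definition tangency_surface ::
  "('a::real_inner) set \<Rightarrow> ('a \<Rightarrow> 'a) \<Rightarrow> ('a \<Rightarrow> real) \<Rightarrow> 'a set" where
  "tangency_surface \<Omega> fL H = {x \<in> disc_surface \<Omega> H. vel fL H x = 0}"

definition invisible_invisible ::
  "('a::real_inner) set \<Rightarrow> ('a \<Rightarrow> 'a) \<Rightarrow> ('a \<Rightarrow> 'a) \<Rightarrow> ('a \<Rightarrow> real) \<Rightarrow> 'a set \<Rightarrow> bool" where
  "invisible_invisible \<Omega> fL fR H S \<longleftrightarrow>
     S \<subseteq> tangency_surface \<Omega> fL H \<and> (\<forall>x\<in>S. lie fL 2 H x > 0 \<and> lie fR 2 H x < 0)"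

definition solution_on ::
  "('a::real_normed_vector) set \<Rightarrow> ('a \<Rightarrow> 'a) \<Rightarrow> 'a \<Rightarrow> real \<Rightarrow> (real \<Rightarrow> 'a) \<Rightarrow> bool" where
  "solution_on \<Omega> f x T \<phi> \<longleftrightarrow> \<phi> 0 = x \<and>
     (\<forall>t\<in>{0..T}. \<phi> t \<in> \<Omega> \<and> (\<phi> has_vector_derivative f (\<phi> t)) (at t within {0..T}))"

text \<open>\<open>T\<close> is the time and \<open>y\<close> the location of the first return of the forward orbit of \<open>x\<close>
  to the discontinuity surface.\<close>

definition first_return ::
  "('a::real_normed_vector) set \<Rightarrow> ('a \<Rightarrow> real) \<Rightarrow> ('a \<Rightarrow> 'a) \<Rightarrow> 'a \<Rightarrow> real \<Rightarrow> 'a \<Rightarrow> bool" where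
  "first_return \<Omega> H f x T y \<longleftrightarrow> T > 0 \<and>
     (\<exists>\<phi>. solution_on \<Omega> f x T \<phi> \<and> \<phi> T = y \<and> y \<in> disc_surface \<Omega> H \<and>
       (\<forall>t. 0 < t \<and> t < T \<longrightarrow> \<phi> t \<notin> disc_surface \<Omega> H))"

text \<open>For a \<open>C\<^sup>1\<close> vector field on an open set uniqueness is automatic; it is demanded here so that
  the definite descriptions below are meaningful whenever \<open>returns\<close> holds.\<close>

definition returns ::
  "('a::real_normed_vector) set \<Rightarrow> ('a \<Rightarrow> real) \<Rightarrow> ('a \<Rightarrow> 'a) \<Rightarrow> 'a \<Rightarrow> bool" where
  "returns \<Omega> H f x \<longleftrightarrow> (\<exists>!p. first_return \<Omega> H f x (fst p) (snd p))"

definition return_time ::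
  "('a::real_normed_vector) set \<Rightarrow> ('a \<Rightarrow> real) \<Rightarrow> ('a \<Rightarrow> 'a) \<Rightarrow> 'a \<Rightarrow> real" where
  "return_time \<Omega> H f x = (THE T. \<exists>y. first_return \<Omega> H f x T y)"

definition return_point ::
  "('a::real_normed_vector) set \<Rightarrow> ('a \<Rightarrow> real) \<Rightarrow> ('a \<Rightarrow> 'a) \<Rightarrow> 'a \<Rightarrow> 'a" where
  "return_point \<Omega> H f x = (THE y. \<exists>T. first_return \<Omega> H f x T y)"

text \<open>The domains of \<open>P\<^sub>R = return_point \<Omega> H fR\<close> and \<open>P\<^sub>L = return_point \<Omega> H fL\<close> carry the sign
  conditions on \<open>V\<close>.\<close>

definition dom_PR ::
  "('a::real_inner) set \<Rightarrow> ('a \<Rightarrow> 'a) \<Rightarrow> ('a \<Rightarrow> 'a) \<Rightarrow> ('a \<Rightarrow> real) \<Rightarrow> 'a set" where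
  "dom_PR \<Omega> fL fR H = {x \<in> disc_surface \<Omega> H. vel fL H x > 0 \<and> returns \<Omega> H fR x}"

definition dom_PL ::
  "('a::real_inner) set \<Rightarrow> ('a \<Rightarrow> 'a) \<Rightarrow> ('a \<Rightarrow> real) \<Rightarrow> 'a set" where
  "dom_PL \<Omega> fL H = {x \<in> disc_surface \<Omega> H. vel fL H x < 0 \<and> returns \<Omega> H fL x}"

definition dom_P ::
  "('a::real_inner) set \<Rightarrow> ('a \<Rightarrow> 'a) \<Rightarrow> ('a \<Rightarrow> 'a) \<Rightarrow> ('a \<Rightarrow> real) \<Rightarrow> 'a set" where
  "dom_P \<Omega> fL fR H = {x \<in> dom_PR \<Omega> fL fR H. return_point \<Omega> H fR x \<in> dom_PL \<Omega> fL H}"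

definition P_map ::
  "('a::real_inner) set \<Rightarrow> ('a \<Rightarrow> 'a) \<Rightarrow> ('a \<Rightarrow> 'a) \<Rightarrow> ('a \<Rightarrow> real) \<Rightarrow> 'a \<Rightarrow> 'a" where
  "P_map \<Omega> fL fR H = return_point \<Omega> H fL \<circ> return_point \<Omega> H fR"

definition tau ::
  "('a::real_inner) set \<Rightarrow> ('a \<Rightarrow> 'a) \<Rightarrow> ('a \<Rightarrow> 'a) \<Rightarrow> ('a \<Rightarrow> real) \<Rightarrow> 'a \<Rightarrow> real" where
  "tau \<Omega> fL fR H x = return_time \<Omega> H fL (return_point \<Omega> H fR x) + return_time \<Omega> H fR x"

definition Lambda ::
  "('a::real_inner \<Rightarrow> 'a) \<Rightarrow> ('a \<Rightarrow> 'a) \<Rightarrow> ('a \<Rightarrow> real) \<Rightarrow> 'a \<Rightarrow> real" where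
  "Lambda fL fR H x =
     lie fL 3 H x / (lie fL 2 H x)\<^sup>2 - lie fR 3 H x / (lie fR 2 H x)\<^sup>2"

end

theory Submission
  imports Defs "HOL-Library.Landau_Symbols"
begin

text \<open>Along an orbit starting at \<open>x \<in> \<Sigma>\<close> the function \<open>t \<mapsto> H (\<phi> t)\<close> has the Lie derivatives of
  \<open>H\<close> at \<open>x\<close> as Taylor coefficients: with velocity \<open>w\<close>, second derivative \<open>a\<close> and third
  derivative \<open>b\<close> it is \<open>w t + a t\<^sup>2 / 2 + b t\<^sup>3 / 6 + O(t\<^sup>4)\<close>. If \<open>a < 0 < w\<close> and \<open>w\<close> is small, it is
  concave, so its first positive zero is \<open>T = - 2 w / a + O(w\<^sup>2)\<close>, where the velocity has become
  \<open>- w + 2 b w\<^sup>2 / (3 a\<^sup>2) + O(w\<^sup>3)\<close>. This covers \<open>P\<^sub>R\<close> directly and \<open>P\<^sub>L\<close> after replacing \<open>H\<close> by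
  \<open>- H\<close>; refraction makes the outgoing velocity of the first passage the incoming one of the
  second. All constants are uniform because the Lie derivatives are continuous, and those of order
  two and three Lipschitz, on a compact neighbourhood of \<open>S\<close>.\<close>

section \<open>Lie derivatives of class \<open>C\<^sup>k\<close> functions\<close>

text \<open>The expansions presuppose that a return exists and is unique, and
  \<open>first_return\<close> admits arbitrary solutions, so orbits must be controlled first. Only
  times of order \<nu> occur, so a lifetime \<open>\<delta>\<close> may be chosen with
  \<open>L * \<delta> < 1\<close> and \<open>M * \<delta> < r\<close>. The first makes the Picard
  map contract in the plain sup norm and replaces Gronwall in the uniqueness argument; the second
  confines orbits to a ball on which all constants hold. The second passage has its coefficients at
  the intermediate point, while the theorem wants them at \<open>x\<close>. The two points are
  O(\<nu>) apart, so Lipschitz coefficients alter each term only at the next order. This is what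
  fixes the smoothness: for \<open>H\<close> of class \<open>C\<^sup>4\<close> the third Lie
  derivative is still \<open>C\<^sup>1\<close>, and the fourth, which bounds the Taylor remainder,
  is continuous. Constants must serve all starting points at once. A single passage is therefore
  estimated by explicit inequalities, and the passages are composed in Landau notation over a
  principal filter, where O means one bound on a whole set and no limit.\<close>

lemma Ck_on_imp_continuous_on:
  assumes "Ck_on k f S"
  shows "continuous_on S f"
proof (cases k)
  case (Suc m)
  then show ?thesis
    using assms
    by (simp add: continuous_at_imp_continuous_on differentiable_imp_continuous_within)
qed (use assms in simp)

lemma Ck_on_SucD: "Ck_on (Suc k) f S \<Longrightarrow> Ck_on k f S"
proof (induction k arbitrary: f)
  case 0
  then show ?case using Ck_on_imp_continuous_on[OF 0] by simp
next
  case (Suc k)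
  then show ?case by (metis Ck_on.simps(2))
qed

lemma Ck_on_le: "Ck_on k f S \<Longrightarrow> m \<le> k \<Longrightarrow> Ck_on m f S"
  by (induction k) (auto simp: le_Suc_eq dest: Ck_on_SucD simp del: Ck_on.simps)

lemma Ck_on_Suc_derivative:
  assumes "Ck_on (Suc k) f S"
  shows "x \<in> S \<Longrightarrow> (f has_derivative frechet_derivative f (at x)) (at x)"
    and "Ck_on k (\<lambda>x. frechet_derivative f (at x) v) S"
  using assms by (simp_all add: frechet_derivative_works)

text \<open>Openness matters: the derivative at a point of \<open>S\<close> sees a neighbourhood, on
  which the two functions must agree.\<close>

lemma Ck_on_cong:
  assumes "open S" "Ck_on k f S" "\<And>x. x \<in> S \<Longrightarrow> f x = g x"
  shows "Ck_on k g S"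
  using assms(2,3)
proof (induction k arbitrary: f g)
  case 0
  have "continuous_on S f \<longleftrightarrow> continuous_on S g"
    by (rule continuous_on_cong[OF refl]) (rule 0)
  then show ?case using 0(1) by (simp only: Ck_on.simps)
next
  case (Suc k)
  have fd: "(g has_derivative frechet_derivative f (at x)) (at x)" if "x \<in> S" for x
    by (rule has_derivative_transform_within_open[OF Ck_on_Suc_derivative(1)[OF Suc.prems(1) that]
          assms(1) that Suc.prems(2)])
  have "Ck_on k (\<lambda>x. frechet_derivative g (at x) v) S" for v
  proof (rule Suc.IH)
    show "Ck_on k (\<lambda>x. frechet_derivative f (at x) v) S"
      by (rule Ck_on_Suc_derivative(2)[OF Suc.prems(1)])
  qed (use frechet_derivative_at[OF fd] in simp)
  then show ?case
    using fd by (auto simp: differentiable_def)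
qed

text \<open>Uniqueness of derivatives allows any formula \<open>f'\<close> in place of the chosen
  \<open>frechet_derivative\<close>.\<close>

lemma Ck_on_SucI:
  assumes "open S" "\<And>x. x \<in> S \<Longrightarrow> (f has_derivative f' x) (at x)"
    and "\<And>v. Ck_on k (\<lambda>x. f' x v) S"
  shows "Ck_on (Suc k) f S"
proof -
  have "Ck_on k (\<lambda>x. frechet_derivative f (at x) v) S" for v
    by (rule Ck_on_cong[OF assms(1) assms(3)[of v]])
      (use frechet_derivative_at[OF assms(2)] in simp)
  then show ?thesis
    using assms(2) by (auto simp: differentiable_def)
qed

section \<open>Closure properties of class \<open>C\<^sup>k\<close>\<close>

lemma Ck_on_const: "open S \<Longrightarrow> Ck_on k (\<lambda>x. c) S"
  by (induction k arbitrary: c) simp_all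

lemma Ck_on_add:
  assumes "open S" "Ck_on k f S" "Ck_on k g S"
  shows "Ck_on k (\<lambda>x. f x + g x) S"
  using assms(2,3)
proof (induction k arbitrary: f g)
  case 0
  then show ?case by (simp add: continuous_on_add)
next
  case (Suc k)
  show ?case
    by (rule Ck_on_SucI[OF assms(1) has_derivative_add[OF Suc.prems[THEN Ck_on_Suc_derivative(1)]]])
      (simp_all add: Suc.IH[OF Suc.prems[THEN Ck_on_Suc_derivative(2)]])
qed

lemma Ck_on_sum:
  assumes "open S" "\<And>i. i \<in> I \<Longrightarrow> Ck_on k (f i) S"
  shows "Ck_on k (\<lambda>x. \<Sum>i\<in>I. f i x) S"
  using assms(2)
  by (induction I rule: infinite_finite_induct)
    (simp_all add: Ck_on_add Ck_on_const \<open>open S\<close> del: Ck_on.simps)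

lemma Ck_on_bounded_linear:
  assumes "open S" "bounded_linear L" "Ck_on k f S"
  shows "Ck_on k (\<lambda>x. L (f x)) S"
  using assms(3)
proof (induction k arbitrary: f)
  case 0
  then show ?case
    using bounded_linear.continuous_on[OF assms(2)] by simp
next
  case (Suc k)
  show ?case
    by (rule Ck_on_SucI[OF assms(1) bounded_linear.has_derivative[OF assms(2)
            Ck_on_Suc_derivative(1)[OF Suc.prems]]])
      (simp_all add: Suc.IH[OF Ck_on_Suc_derivative(2)[OF Suc.prems]])
qed

lemma Ck_on_mult:
  fixes f g :: "'a::real_normed_vector \<Rightarrow> 'b::real_normed_algebra"
  assumes "open S" "Ck_on k f S" "Ck_on k g S"
  shows "Ck_on k (\<lambda>x. f x * g x) S"
  using assms(2,3)
proof (induction k arbitrary: f g)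
  case 0
  then show ?case by (simp add: continuous_on_mult)
next
  case (Suc k)
  \<comment> \<open>The product rule leaves one factor undifferentiated; \<open>C\<close> provides
    it in class \<open>C\<^sup>k\<close>.\<close>
  note D = Suc.prems[THEN Ck_on_Suc_derivative(2)] and C = Suc.prems[THEN Ck_on_SucD]
  show ?case
    by (rule Ck_on_SucI[OF assms(1) has_derivative_mult[OF Suc.prems[THEN Ck_on_Suc_derivative(1)]]])
      (simp_all add: Ck_on_add[OF assms(1) Suc.IH[OF C(1) D(2)] Suc.IH[OF D(1) C(2)]])
qed

section \<open>Gradients and Lie derivatives\<close>

lemma GDERIV_unique:
  fixes h :: "'a::real_inner \<Rightarrow> real"
  assumes "GDERIV h x :> D" "GDERIV h x :> E"
  shows "D = E"
proof -
  have "\<forall>v. v \<bullet> D = v \<bullet> E"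
    by (intro allI fun_cong[OF has_derivative_unique[OF assms[unfolded gderiv_def]]])
  then show ?thesis
    by (simp only: vector_eq_ldot)
qed

lemma GDERIV_grad:
  fixes h :: "'a::euclidean_space \<Rightarrow> real"
  assumes "h differentiable (at x)"
  shows "GDERIV h x :> grad h x"
proof -
  \<comment> \<open>The Riesz representative of the derivative: the adjoint of a functional, applied
    to 1.\<close>
  let ?D = "adjoint (frechet_derivative h (at x)) 1"
  have lin: "linear (frechet_derivative h (at x))"
    by (rule linear_frechet_derivative[OF assms])
  have "frechet_derivative h (at x) v = v \<bullet> ?D" for v
    using adjoint_works[OF lin, of v 1] by simp
  then have "frechet_derivative h (at x) = (\<lambda>v. v \<bullet> ?D)" by (rule ext)
  then have D: "GDERIV h x :> ?D"
    using iffD1[OF frechet_derivative_works assms] by (simp only: gderiv_def)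
  show ?thesis
    unfolding grad_def using D by (rule theI) (erule GDERIV_unique[OF _ D])
qed

lemma grad_eqI:
  fixes h :: "'a::euclidean_space \<Rightarrow> real"
  assumes "GDERIV h x :> D"
  shows "grad h x = D"
  using GDERIV_unique[OF GDERIV_grad assms] assms
  by (auto simp: gderiv_def differentiable_def)

lemma frechet_derivative_eq_grad:
  fixes h :: "'a::euclidean_space \<Rightarrow> real"
  assumes "h differentiable (at x)"
  shows "frechet_derivative h (at x) v = grad h x \<bullet> v"
  using fun_cong[OF frechet_derivative_at[OF GDERIV_grad[OF assms, unfolded gderiv_def]], of v]
  by (simp add: inner_commute)

text \<open>\<open>Ck_on\<close> speaks of directional derivatives, so the inner product is expanded
  over \<open>Basis\<close> into a finite sum of products of \<open>C\<^sup>k\<close>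
  functions.\<close>

lemma Ck_on_grad_inner:
  fixes h :: "'a::euclidean_space \<Rightarrow> real"
  assumes "open S" "Ck_on (Suc k) h S" "Ck_on k f S"
  shows "Ck_on k (\<lambda>x. grad h x \<bullet> f x) S"
proof (rule Ck_on_cong[OF \<open>open S\<close>])
  show "Ck_on k (\<lambda>x. \<Sum>b\<in>Basis. frechet_derivative h (at x) b * (f x \<bullet> b)) S"
    using assms
    by (intro Ck_on_sum Ck_on_mult Ck_on_bounded_linear[OF _ bounded_linear_inner_left]) auto
  fix x assume "x \<in> S"
  then have "frechet_derivative h (at x) b = grad h x \<bullet> b" for b
    using assms(2) by (auto intro: frechet_derivative_eq_grad)
  then show "(\<Sum>b\<in>Basis. frechet_derivative h (at x) b * (f x \<bullet> b)) = grad h x \<bullet> f x"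
    by (subst euclidean_inner[of "grad h x"]) simp
qed

text \<open>Each Lie derivative costs one order of \<open>h\<close>, and \<open>f\<close> may be one
  order less smooth than \<open>h\<close>, since it enters only after a differentiation.\<close>

lemma Ck_on_lie:
  fixes h :: "'a::euclidean_space \<Rightarrow> real"
  assumes "open S" "Ck_on (Suc k) h S" "Ck_on k f S" "m \<le> Suc k"
  shows "Ck_on (Suc k - m) (lie f m h) S"
  using assms(4)
proof (induction m)
  case 0
  then show ?case using assms by simp
next
  case (Suc m)
  then have "Suc k - m = Suc (k - m)" by simp
  then show ?case
    using Suc assms(1) Ck_on_le[OF assms(3), of "k - m"]
    by (simp del: Ck_on.simps add: Ck_on_grad_inner)
qed

lemma GDERIV_lie:
  fixes h :: "'a::euclidean_space \<Rightarrow> real"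
  assumes "open S" "Ck_on (Suc k) h S" "Ck_on k f S" "m \<le> k" "x \<in> S"
  shows "GDERIV (lie f m h) x :> grad (lie f m h) x"
proof -
  have "Ck_on (Suc (k - m)) (lie f m h) S"
    using Ck_on_lie[OF assms(1-3), of m] assms(4) by (simp add: Suc_diff_le del: Ck_on.simps)
  then show ?thesis
    using assms(5) by (intro GDERIV_grad) simp
qed

text \<open>Chain rule along an orbit. The case \<open>m = k\<close> is included because
  \<open>lie f k h\<close> is still \<open>C\<^sup>1\<close>; for \<open>k = 3\<close> this yields
  four derivatives in time.\<close>

lemma lie_along_solution:
  fixes h :: "'a::euclidean_space \<Rightarrow> real"
  assumes "open S" "Ck_on (Suc k) h S" "Ck_on k f S" "m \<le> k" "\<phi> t \<in> S"
    and "(\<phi> has_vector_derivative f (\<phi> t)) (at t within I)"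
  shows "((\<lambda>t. lie f m h (\<phi> t)) has_real_derivative lie f (Suc m) h (\<phi> t)) (at t within I)"
proof -
  have "(lie f m h has_derivative (\<lambda>v. v \<bullet> grad (lie f m h) (\<phi> t))) (at (\<phi> t))"
    using GDERIV_lie[OF assms(1-5)] by (simp add: gderiv_def)
  then have "((\<lambda>t. lie f m h (\<phi> t)) has_derivative
      (\<lambda>s. (s *\<^sub>R f (\<phi> t)) \<bullet> grad (lie f m h) (\<phi> t))) (at t within I)"
    using has_derivative_compose assms(6) unfolding has_vector_derivative_def by fastforce
  then show ?thesis
    by (simp add: has_field_derivative_def inner_commute mult_commute_abs)
qed

lemma lie_uminus:
  fixes h :: "'a::euclidean_space \<Rightarrow> real"
  assumes "open S" "Ck_on (Suc k) h S" "Ck_on k f S" "m \<le> Suc k" "x \<in> S"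
  shows "lie f m (\<lambda>x. - h x) x = - lie f m h x"
  using assms(4,5)
proof (induction m arbitrary: x)
  case (Suc m)
  have "GDERIV (\<lambda>y. - lie f m h y) x :> - grad (lie f m h) x"
    using Suc.prems by (intro GDERIV_minus GDERIV_lie[OF assms(1-3)]) auto
  then have "GDERIV (lie f m (\<lambda>x. - h x)) x :> - grad (lie f m h) x"
    \<comment> \<open>The induction hypothesis is an equality on \<open>S\<close> only, so the
      derivative is transferred within this open set.\<close>
    unfolding gderiv_def using Suc assms(1)
    by (elim has_derivative_transform_within_open) auto
  then have "grad (lie f m (\<lambda>x. - h x)) x = - grad (lie f m h) x"
    by (rule grad_eqI)
  then show ?case
    by simp
qed simp

lemma Ck_on_uminus: "open S \<Longrightarrow> Ck_on k f S \<Longrightarrow> Ck_on k (\<lambda>x. - f x) S"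
  by (rule Ck_on_bounded_linear[OF _ bounded_linear_minus[OF bounded_linear_ident]])

text \<open>The compact sets in use are unions of balls and need not be convex, so the mean value
  inequality is applied along segments inside \<open>K\<close>. Continuity is given for directional
  derivatives, hence the operator norm is bounded by the sum of their bounds over
  \<open>Basis\<close>.\<close>

lemma C1_lipschitz_on_compact:
  fixes g :: "'a::euclidean_space \<Rightarrow> 'b::real_normed_vector"
  assumes "Ck_on (Suc 0) g S" "compact K" "K \<subseteq> S"
  obtains L where "L \<ge> 0"
    "\<And>x y. closed_segment x y \<subseteq> K \<Longrightarrow> norm (g x - g y) \<le> L * norm (x - y)"
proof -
  have "\<exists>B. \<forall>x\<in>K. norm (frechet_derivative g (at x) b) \<le> B" for b
  proof -
    have "continuous_on K (\<lambda>x. frechet_derivative g (at x) b)"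
      using Ck_on_imp_continuous_on[OF Ck_on_Suc_derivative(2)[OF assms(1)]] assms(3)
      by (rule continuous_on_subset)
    then have "bounded ((\<lambda>x. frechet_derivative g (at x) b) ` K)"
      using assms(2) compact_continuous_image compact_imp_bounded by blast
    then show ?thesis
      by (auto simp: bounded_iff)
  qed
  then obtain B where B: "\<And>b x. x \<in> K \<Longrightarrow> norm (frechet_derivative g (at x) b) \<le> B b"
    by metis
  define L where "L = (\<Sum>b\<in>Basis. \<bar>B b\<bar>)"
  have on: "onorm (frechet_derivative g (at x)) \<le> L" if x: "x \<in> K" for x
  proof (rule onorm_bound)
    show "L \<ge> 0" unfolding L_def by (rule sum_nonneg) simp
    fix v
    have lin: "linear (frechet_derivative g (at x))"
      by (rule has_derivative_linear[OF Ck_on_Suc_derivative(1)[OF assms(1) subsetD[OF assms(3) x]]])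
    have eq: "frechet_derivative g (at x) v = (\<Sum>b\<in>Basis. (v \<bullet> b) *\<^sub>R frechet_derivative g (at x) b)"
      by (subst (1) euclidean_representation[of v, symmetric])
        (simp only: linear_sum[OF lin] linear_scale[OF lin])
    have "norm (frechet_derivative g (at x) v) \<le> (\<Sum>b\<in>Basis. \<bar>B b\<bar> * norm v)"
      unfolding eq
    proof (rule sum_norm_le)
      fix b :: 'a assume "b \<in> Basis"
      then have "\<bar>v \<bullet> b\<bar> * norm (frechet_derivative g (at x) b) \<le> norm v * \<bar>B b\<bar>"
        using B[OF x, of b] by (intro mult_mono Basis_le_norm) auto
      then show "norm ((v \<bullet> b) *\<^sub>R frechet_derivative g (at x) b) \<le> \<bar>B b\<bar> * norm v"
        by (simp only: norm_scaleR mult.commute[of "\<bar>B b\<bar>"])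
    qed
    then show "norm (frechet_derivative g (at x) v) \<le> L * norm v"
      by (simp only: L_def sum_distrib_right)
  qed
  show thesis
  proof (rule that)
    show "L \<ge> 0" unfolding L_def by (rule sum_nonneg) simp
    fix x y assume *: "closed_segment x y \<subseteq> K"
    show "norm (g x - g y) \<le> L * norm (x - y)"
    proof (rule differentiable_bound[OF convex_closed_segment[of x y], where f' = "\<lambda>x. frechet_derivative g (at x)"])
      fix z assume "z \<in> closed_segment x y"
      then show "(g has_derivative frechet_derivative g (at z)) (at z within closed_segment x y)"
        using * assms(3)
        by (blast intro!: has_derivative_at_withinI[OF Ck_on_Suc_derivative(1)[OF assms(1)]])
      show "onorm (frechet_derivative g (at z)) \<le> L"
        using on * \<open>z \<in> closed_segment x y\<close> by blast
    qed simp_all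
  qed
qed

section \<open>Local existence and uniqueness of solutions\<close>

lemma vector_derivative_bound_interval:
  fixes \<phi> :: "real \<Rightarrow> 'a::real_normed_vector"
  assumes "\<And>t. t \<in> {a..b} \<Longrightarrow> (\<phi> has_vector_derivative \<phi>' t) (at t within {a..b})"
    and "\<And>t. t \<in> {a..b} \<Longrightarrow> norm (\<phi>' t) \<le> B" and "a \<le> b"
  shows "norm (\<phi> b - \<phi> a) \<le> B * (b - a)"
proof -
  have "norm (\<phi> b - \<phi> a) \<le> B * norm (b - a)"
  proof (rule differentiable_bound[of "{a..b}" \<phi> "\<lambda>t h. h *\<^sub>R \<phi>' t"])
    fix t assume t: "t \<in> {a..b}"
    show "(\<phi> has_derivative (\<lambda>h. h *\<^sub>R \<phi>' t)) (at t within {a..b})"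
      using assms(1)[OF t] by (simp only: has_vector_derivative_def)
    show "onorm (\<lambda>h. h *\<^sub>R \<phi>' t) \<le> B"
    proof (rule onorm_bound)
      show "0 \<le> B" by (rule order_trans[OF norm_ge_zero assms(2)[OF t]])
      show "norm (h *\<^sub>R \<phi>' t) \<le> B * norm h" for h
        using mult_right_mono[OF assms(2)[OF t] norm_ge_zero[of h]] by (simp add: mult.commute)
    qed
  qed (use assms(3) in auto)
  then show ?thesis using assms(3) by simp
qed

lemma solution_on_subinterval:
  assumes "solution_on \<Omega> f x T \<phi>" "T' \<le> T"
  shows "solution_on \<Omega> f x T' \<phi>"
proof -
  have "(\<phi> has_vector_derivative f (\<phi> t)) (at t within {0..T'})" if "t \<in> {0..T'}" for t
    by (rule has_vector_derivative_within_subset[of _ _ _ "{0..T}"])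
      (use assms that in \<open>auto simp: solution_on_def\<close>)
  then show ?thesis
    using assms by (auto simp: solution_on_def)
qed

lemma solution_on_continuous_on:
  assumes "solution_on \<Omega> f x T \<phi>"
  shows "continuous_on {0..T} \<phi>"
proof -
  have "continuous (at t within {0..T}) \<phi>" if "t \<in> {0..T}" for t
    using assms that has_vector_derivative_continuous unfolding solution_on_def by blast
  then show ?thesis
    by (simp add: continuous_on_eq_continuous_within)
qed

text \<open>Speed at most \<open>M\<close> cannot cover the distance \<open>r\<close> when
  \<open>M * T < r\<close>. Since the speed is controlled only inside the ball, the estimate is made
  up to the first visit to the sphere.\<close>

lemma solution_on_in_cball:
  fixes \<phi> :: "real \<Rightarrow> 'a::real_normed_vector"
  assumes sol: "solution_on \<Omega> f x T \<phi>"
    and M: "\<And>z. z \<in> cball x r \<Longrightarrow> norm (f z) \<le> M" and "M * T < r" and r: "r > 0" and t: "t \<in> {0..T}"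
  shows "\<phi> t \<in> cball x r"
proof (rule ccontr)
  assume "\<phi> t \<notin> cball x r"
  then have gt: "norm (\<phi> t - x) > r" by (simp add: dist_norm norm_minus_commute)
  let ?A = "{s \<in> {0..t}. norm (\<phi> s - x) = r}"
  have cont: "continuous_on {0..t} (\<lambda>s. norm (\<phi> s - x))"
    using t by (auto intro!: continuous_intros continuous_on_subset[OF solution_on_continuous_on[OF sol]])
  have "closed ?A"
    using continuous_closed_preimage_constant[OF cont] by simp
  moreover have "?A \<noteq> {}"
    using IVT'[of "\<lambda>s. norm (\<phi> s - x)" 0 r t] gt cont t r sol by (auto simp: solution_on_def)
  moreover have "bdd_below ?A" by (auto intro: bdd_belowI[of _ 0])
  ultimately have s: "Inf ?A \<in> ?A" by (intro closed_contains_Inf)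
  define s where "s = Inf ?A"
  \<comment> \<open>Being outside before time \<open>s\<close> would force an earlier crossing of
    the sphere.\<close>
  have before: "\<phi> u \<in> cball x r" if u: "u \<in> {0..s}" for u
  proof (rule ccontr)
    assume "\<phi> u \<notin> cball x r"
    then have "norm (\<phi> u - x) > r" by (simp add: dist_norm norm_minus_commute)
    moreover have "continuous_on {0..u} (\<lambda>s. norm (\<phi> s - x))"
      using cont s u by (auto intro: continuous_on_subset simp: s_def)
    ultimately obtain v where v: "0 \<le> v" "v \<le> u" "norm (\<phi> v - x) = r"
      using IVT'[of "\<lambda>s. norm (\<phi> s - x)" 0 r u] r sol u by (auto simp: solution_on_def)
    then have "v \<in> ?A" using s u by (auto simp: s_def)
    then have "s \<le> v" unfolding s_def by (intro cInf_lower) (auto intro: bdd_belowI[of _ 0])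
    with v u have "v = u" by simp
    with v \<open>norm (\<phi> u - x) > r\<close> show False by simp
  qed
  have "norm (\<phi> s - \<phi> 0) \<le> M * (s - 0)"
    using solution_on_subinterval[OF sol, of s] before M s t
    by (intro vector_derivative_bound_interval[where \<phi>' = "\<lambda>t. f (\<phi> t)"])
      (auto simp: solution_on_def s_def)
  also have "\<dots> \<le> M * T"
    using s t order_trans[OF norm_ge_zero M[of x]] r
    by (intro mult_left_mono) (auto simp: s_def)
  finally show False
    using s sol \<open>M * T < r\<close> by (simp add: s_def solution_on_def)
qed

text \<open>The maximal distance \<open>d\<close> between the two solutions satisfies
  \<open>d \<le> L * T * d\<close> with \<open>L * T < 1\<close>, hence vanishes.\<close>

lemma solution_on_unique:
  fixes \<phi> \<psi> :: "real \<Rightarrow> 'a::real_normed_vector"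
  assumes sol: "solution_on \<Omega> f x T \<phi>" "solution_on \<Omega> f x T \<psi>"
    and in_cball: "\<And>t. t \<in> {0..T} \<Longrightarrow> \<phi> t \<in> B" "\<And>t. t \<in> {0..T} \<Longrightarrow> \<psi> t \<in> B"
    and lip: "\<And>y z. y \<in> B \<Longrightarrow> z \<in> B \<Longrightarrow> norm (f y - f z) \<le> L * norm (y - z)"
    and "L \<ge> 0" "L * T < 1" and t: "t \<in> {0..T}"
  shows "\<phi> t = \<psi> t"
proof -
  let ?d = "\<lambda>t. norm (\<phi> t - \<psi> t)"
  have "continuous_on {0..T} ?d"
    using sol by (intro continuous_intros solution_on_continuous_on)
  then obtain m where m: "m \<in> {0..T}" "\<And>t. t \<in> {0..T} \<Longrightarrow> ?d t \<le> ?d m"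
    using continuous_attains_sup[of "{0..T}" ?d] t by auto
  have "norm ((\<phi> m - \<psi> m) - (\<phi> 0 - \<psi> 0)) \<le> (L * ?d m) * (m - 0)"
  proof (rule vector_derivative_bound_interval)
    fix s assume s: "s \<in> {0..m}"
    then show "((\<lambda>t. \<phi> t - \<psi> t) has_vector_derivative f (\<phi> s) - f (\<psi> s)) (at s within {0..m})"
      using sol[THEN solution_on_subinterval, of m] m
      by (auto simp: solution_on_def intro!: has_vector_derivative_diff)
    have "norm (f (\<phi> s) - f (\<psi> s)) \<le> L * ?d s"
      using s m by (intro lip in_cball) auto
    also have "\<dots> \<le> L * ?d m"
      using m s \<open>L \<ge> 0\<close> by (intro mult_left_mono) auto
    finally show "norm (f (\<phi> s) - f (\<psi> s)) \<le> L * ?d m" .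
  qed (use m in auto)
  then have "?d m \<le> (L * m) * ?d m"
    using sol by (simp add: solution_on_def mult_ac)
  moreover have "L * m \<le> L * T" using m \<open>L \<ge> 0\<close> by (intro mult_left_mono) auto
  ultimately have "?d m = 0"
    using \<open>L * T < 1\<close>
    by (smt (verit, best) mult_le_cancel_right1 norm_ge_zero)
  then show ?thesis using m(2)[OF t] by simp
qed

text \<open>Picard iteration: the integral operator contracts the sup norm by the factor
  \<open>L * T\<close>, so Banach's fixed point theorem applies.\<close>

lemma global_solution_exists:
  fixes g :: "'a::euclidean_space \<Rightarrow> 'a"
  assumes lip: "\<And>y z. norm (g y - g z) \<le> L * norm (y - z)" and "L \<ge> 0" "L * T < 1" "T \<ge> 0"
  obtains \<phi> where "solution_on UNIV g x T \<phi>"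
proof -
  have cg: "continuous_on UNIV g"
    using lip \<open>L \<ge> 0\<close> by (intro lipschitz_on_continuous_on[of L]) (auto simp: lipschitz_on_def dist_norm)
  have cu: "continuous_on A (\<lambda>s. g (apply_bcontfun u s))" for u :: "real \<Rightarrow>\<^sub>C 'a" and A
    by (rule continuous_on_compose2[OF cg]) auto
  \<comment> \<open>The complete space consists of bounded continuous functions on the whole line.
    Clamping time to \<open>{0..T}\<close> makes the images bounded and changes nothing on the
    interval.\<close>
  define c where "c = (\<lambda>t. max 0 (min T t))"
  have c: "c t \<in> {0..T}" for t using \<open>T \<ge> 0\<close> by (auto simp: c_def)
  have c_id: "c t = t" if "t \<in> {0..T}" for t using that by (auto simp: c_def)
  define P where "P u = (\<lambda>t. x + integral {0..c t} (\<lambda>s. g (apply_bcontfun u s)))" for u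
  have ci: "continuous_on {0..T} (\<lambda>t. x + integral {0..t} (\<lambda>s. g (apply_bcontfun u s)))" for u
    by (intro continuous_intros indefinite_integral_continuous_1 integrable_continuous_real cu)
  have "P u \<in> bcontfun" for u
  proof -
    have "continuous_on UNIV (P u)"
      unfolding P_def
      by (rule continuous_on_compose2[OF ci]) (use c in \<open>auto simp: c_def intro!: continuous_intros\<close>)
    moreover have "range (P u) \<subseteq> (\<lambda>t. x + integral {0..t} (\<lambda>s. g (apply_bcontfun u s))) ` {0..T}"
      using c by (auto simp: P_def)
    then have "bounded (range (P u))"
      by (rule bounded_subset[OF compact_imp_bounded[OF compact_continuous_image[OF ci compact_Icc]]])
    ultimately show ?thesis by (simp add: bcontfun_def)
  qed
  then have ap: "apply_bcontfun (Bcontfun (P u)) = P u" for u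
    by (simp add: Bcontfun_inverse)
  have "dist (Bcontfun (P u)) (Bcontfun (P v)) \<le> (L * T) * dist u v" for u v
  proof (rule dist_bound)
    fix t
    have "P u t - P v t = integral {0..c t} (\<lambda>s. g (apply_bcontfun u s) - g (apply_bcontfun v s))"
      unfolding P_def
      by (subst integral_diff) (auto intro!: integrable_continuous_real cu)
    also have "norm \<dots> \<le> (L * dist u v) * (c t - 0)"
    proof (rule integral_bound)
      fix s
      have "norm (g (apply_bcontfun u s) - g (apply_bcontfun v s)) \<le> L * dist (apply_bcontfun u s) (apply_bcontfun v s)"
        using lip by (simp add: dist_norm)
      also have "\<dots> \<le> L * dist u v"
        using \<open>L \<ge> 0\<close> by (intro mult_left_mono dist_bounded)
      finally show "norm (g (apply_bcontfun u s) - g (apply_bcontfun v s)) \<le> L * dist u v" .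
    qed (use c in \<open>auto intro!: continuous_intros cu\<close>)
    also have "\<dots> \<le> (L * dist u v) * T"
      using c[of t] \<open>L \<ge> 0\<close> by (intro mult_left_mono) auto
    finally show "dist (apply_bcontfun (Bcontfun (P u)) t) (apply_bcontfun (Bcontfun (P v)) t) \<le> L * T * dist u v"
      by (simp add: ap dist_norm mult_ac)
  qed
  then obtain u where "Bcontfun (P u) = u"
    using banach_fix_type[of "L * T" "\<lambda>u. Bcontfun (P u)"] assms by auto
  then have u: "apply_bcontfun u = P u" using ap[of u] by simp
  let ?I = "\<lambda>t. integral {0..t} (\<lambda>s. g (apply_bcontfun u s))"
  have fixpoint: "apply_bcontfun u t = x + ?I t" if "t \<in> {0..T}" for t
    by (subst u) (simp only: P_def c_id[OF that])
  have "solution_on UNIV g x T (apply_bcontfun u)"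
    unfolding solution_on_def
  proof (intro conjI ballI)
    show "apply_bcontfun u 0 = x"
      using fixpoint[of 0] \<open>T \<ge> 0\<close> by simp
    fix t assume t: "t \<in> {0..T}"
    have "(?I has_vector_derivative g (apply_bcontfun u t)) (at t within {0..T})"
      by (rule integral_has_vector_derivative[OF cu t])
    then have "((\<lambda>t. x + ?I t) has_vector_derivative 0 + g (apply_bcontfun u t)) (at t within {0..T})"
      by (rule has_vector_derivative_add[OF has_vector_derivative_const])
    then show "(apply_bcontfun u has_vector_derivative g (apply_bcontfun u t)) (at t within {0..T})"
      unfolding add_0 by (rule has_vector_derivative_transform[OF t, rotated]) (rule fixpoint)
  qed auto
  then show thesis by (rule that)
qed

text \<open>Composing \<open>f\<close> with the nearest-point projection, which is nonexpansive,
  extends it globally with the same \<open>L\<close> and \<open>M\<close>. The solution stays in the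
  ball, where the extension agrees with \<open>f\<close>.\<close>

lemma local_solution_exists:
  fixes f :: "'a::euclidean_space \<Rightarrow> 'a"
  assumes lip: "\<And>y z. y \<in> cball x r \<Longrightarrow> z \<in> cball x r \<Longrightarrow> norm (f y - f z) \<le> L * norm (y - z)"
    and M: "\<And>z. z \<in> cball x r \<Longrightarrow> norm (f z) \<le> M"
    and "L \<ge> 0" "L * T < 1" "T \<ge> 0" "M * T < r" "r > 0"
  obtains \<phi> where "solution_on (cball x r) f x T \<phi>"
proof -
  let ?p = "closest_point (cball x r)"
  have p: "?p y \<in> cball x r" for y
    using \<open>r > 0\<close> by (intro closest_point_in_set) auto
  have "norm (f (?p y) - f (?p z)) \<le> L * norm (y - z)" for y z
  proof -
    have "norm (?p y - ?p z) \<le> norm (y - z)"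
      using closest_point_lipschitz[of "cball x r" y z] \<open>r > 0\<close> by (auto simp: dist_norm)
    from lip[OF p p] mult_left_mono[OF this \<open>L \<ge> 0\<close>] show ?thesis
      by (rule order_trans)
  qed
  then obtain \<phi> where sol: "solution_on UNIV (\<lambda>y. f (?p y)) x T \<phi>"
    using global_solution_exists[of "\<lambda>y. f (?p y)" L T x] assms by blast
  have "\<phi> t \<in> cball x r" if "t \<in> {0..T}" for t
    by (rule solution_on_in_cball[OF sol _ \<open>M * T < r\<close> \<open>r > 0\<close> that]) (rule M[OF p])
  then have "solution_on (cball x r) f x T \<phi>"
    using sol by (auto simp: solution_on_def closest_point_self)
  then show thesis by (rule that)
qed

section \<open>The first zero of a concave function\<close>

lemma mvt_within:
  fixes g :: "real \<Rightarrow> real"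
  assumes "\<And>t. t \<in> I \<Longrightarrow> (g has_real_derivative g' t) (at t within I)" "{a..b} \<subseteq> I" "a < b"
  obtains \<xi> where "a < \<xi>" "\<xi> < b" "g b - g a = g' \<xi> * (b - a)"
proof -
  have "(g has_derivative (*) (g' t)) (at t within {a..b})" if "a \<le> t" "t \<le> b" for t
    using DERIV_subset[OF assms(1) assms(2)] that assms(2)
    by (auto simp: has_field_derivative_def)
  from mvt_simple[OF assms(3) this] that show thesis by auto
qed

text \<open>One integration of a power bound, done by the mean value theorem. The factor
  \<open>1 / Suc m\<close> is given away, so the Taylor remainders carry \<open>B\<close> without a
  factorial.\<close>

lemma taylor_step:
  fixes g :: "real \<Rightarrow> real"
  assumes "\<And>t. t \<in> {0..\<delta>} \<Longrightarrow> (g has_real_derivative g' t) (at t within {0..\<delta>})"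
    and "\<And>t. t \<in> {0..\<delta>} \<Longrightarrow> \<bar>g' t\<bar> \<le> B * t ^ m" and "B \<ge> 0" and t: "t \<in> {0..\<delta>}"
  shows "\<bar>g t - g 0\<bar> \<le> B * t ^ Suc m"
proof (cases "t = 0")
  case False
  then have "0 < t" using t by simp
  moreover have "{0..t} \<subseteq> {0..\<delta>}" using t by auto
  ultimately obtain \<xi> where \<xi>: "0 < \<xi>" "\<xi> < t" "g t - g 0 = g' \<xi> * (t - 0)"
    using mvt_within[of "{0..\<delta>}" g g' 0 t] assms(1) by metis
  have "\<bar>g' \<xi>\<bar> \<le> B * \<xi> ^ m" using assms(2)[of \<xi>] \<xi> t by auto
  also have "\<dots> \<le> B * t ^ m" using \<xi> \<open>B \<ge> 0\<close> by (intro mult_left_mono power_mono) auto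
  finally have "\<bar>g' \<xi>\<bar> * t \<le> B * t ^ m * t" using \<open>0 < t\<close> by (intro mult_right_mono) auto
  then show ?thesis using \<xi> \<open>0 < t\<close> by (simp add: abs_mult mult_ac)
qed simp

text \<open>Descending from the bound on \<open>h 4\<close>, the Taylor polynomial is subtracted at
  each level, and each \<open>taylor_step\<close> gains one power of \<open>t\<close>.\<close>

lemma taylor_bounds:
  fixes h :: "nat \<Rightarrow> real \<Rightarrow> real"
  assumes D: "\<And>m t. m \<le> 3 \<Longrightarrow> t \<in> {0..\<delta>} \<Longrightarrow>
      (h m has_real_derivative h (Suc m) t) (at t within {0..\<delta>})"
    and B: "\<And>t. t \<in> {0..\<delta>} \<Longrightarrow> \<bar>h 4 t\<bar> \<le> B" and t: "t \<in> {0..\<delta>}"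
  shows "\<bar>h 0 t - (h 0 0 + h 1 0 * t + h 2 0 * t\<^sup>2 / 2 + h 3 0 * t ^ 3 / 6)\<bar> \<le> B * t ^ 4"
    and "\<bar>h 1 t - (h 1 0 + h 2 0 * t + h 3 0 * t\<^sup>2 / 2)\<bar> \<le> B * t ^ 3"
proof -
  have nums: "Suc 0 = 1" "Suc 1 = 2" "Suc 2 = 3" "Suc 3 = 4" by simp_all
  have "B \<ge> 0" using B[OF t] by linarith
  note D0 = D[of 0, unfolded nums] and D1 = D[of 1, unfolded nums]
    and D2 = D[of 2, unfolded nums] and D3 = D[of 3, unfolded nums]
  have T3: "\<bar>h 3 t - h 3 0\<bar> \<le> B * t ^ 1" if "t \<in> {0..\<delta>}" for t
    using taylor_step[OF D3 _ \<open>B \<ge> 0\<close> that, of 0] B by simp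
  have T2: "\<bar>(h 2 t - h 3 0 * t) - (h 2 0 - h 3 0 * 0)\<bar> \<le> B * t ^ Suc 1" if "t \<in> {0..\<delta>}" for t
  proof (rule taylor_step[OF _ T3 \<open>B \<ge> 0\<close> that])
    fix t assume "t \<in> {0..\<delta>}"
    then show "((\<lambda>t. h 2 t - h 3 0 * t) has_real_derivative h 3 t - h 3 0) (at t within {0..\<delta>})"
      by (auto intro!: derivative_eq_intros D2)
  qed
  have T1: "\<bar>(h 1 t - (h 2 0 * t + h 3 0 * t\<^sup>2 / 2)) - (h 1 0 - (h 2 0 * 0 + h 3 0 * 0\<^sup>2 / 2))\<bar>
      \<le> B * t ^ Suc 2" if "t \<in> {0..\<delta>}" for t
  proof (rule taylor_step[OF _ _ \<open>B \<ge> 0\<close> that])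
    fix t assume t: "t \<in> {0..\<delta>}"
    then show "((\<lambda>t. h 1 t - (h 2 0 * t + h 3 0 * t\<^sup>2 / 2)) has_real_derivative
        h 2 t - (h 2 0 + h 3 0 * t)) (at t within {0..\<delta>})"
      by (auto intro!: derivative_eq_intros D1[unfolded One_nat_def])
    show "\<bar>h 2 t - (h 2 0 + h 3 0 * t)\<bar> \<le> B * t ^ 2"
      using T2[OF t, unfolded nums] by (simp add: algebra_simps)
  qed
  then show "\<bar>h 1 t - (h 1 0 + h 2 0 * t + h 3 0 * t\<^sup>2 / 2)\<bar> \<le> B * t ^ 3"
    using t unfolding nums by (simp add: algebra_simps)
  have "\<bar>(h 0 t - (h 1 0 * t + h 2 0 * t\<^sup>2 / 2 + h 3 0 * t ^ 3 / 6))
      - (h 0 0 - (h 1 0 * 0 + h 2 0 * 0\<^sup>2 / 2 + h 3 0 * 0 ^ 3 / 6))\<bar> \<le> B * t ^ Suc 3"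
  proof (rule taylor_step[OF _ _ \<open>B \<ge> 0\<close> t])
    fix t assume t: "t \<in> {0..\<delta>}"
    then show "((\<lambda>t. h 0 t - (h 1 0 * t + h 2 0 * t\<^sup>2 / 2 + h 3 0 * t ^ 3 / 6)) has_real_derivative
        h 1 t - (h 1 0 + h 2 0 * t + h 3 0 * t\<^sup>2 / 2)) (at t within {0..\<delta>})"
      by (auto intro!: derivative_eq_intros D0)
    show "\<bar>h 1 t - (h 1 0 + h 2 0 * t + h 3 0 * t\<^sup>2 / 2)\<bar> \<le> B * t ^ 3"
      using T1[OF t, unfolded nums] by (simp add: algebra_simps)
  qed
  then show "\<bar>h 0 t - (h 0 0 + h 1 0 * t + h 2 0 * t\<^sup>2 / 2 + h 3 0 * t ^ 3 / 6)\<bar> \<le> B * t ^ 4"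
    unfolding nums by (simp add: algebra_simps)
qed

text \<open>\<open>g\<close> lies below the parabola \<open>g1 0 * t - a * t\<^sup>2 / 2\<close>,
  which vanishes at \<open>2 * g1 0 / a\<close>, so there is a zero \<open>T\<close> up to that
  time. It is automatically the first one: a further zero between 0 and \<open>T\<close> would give
  two zeros of \<open>g1\<close> and then one of \<open>g2\<close> by Rolle.\<close>

lemma concave_first_zero:
  fixes g g1 g2 :: "real \<Rightarrow> real"
  assumes D0: "\<And>t. t \<in> {0..\<delta>} \<Longrightarrow> (g has_real_derivative g1 t) (at t within {0..\<delta>})"
    and D1: "\<And>t. t \<in> {0..\<delta>} \<Longrightarrow> (g1 has_real_derivative g2 t) (at t within {0..\<delta>})"
    and g2: "\<And>t. t \<in> {0..\<delta>} \<Longrightarrow> g2 t \<le> - a" and "a > 0"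
    and "g 0 = 0" "g1 0 > 0" "2 * g1 0 / a < \<delta>"
  obtains T where "0 < T" "T \<le> 2 * g1 0 / a" "g T = 0" "\<And>t. 0 < t \<Longrightarrow> t < T \<Longrightarrow> g t \<noteq> 0"
proof -
  define t0 where "t0 = 2 * g1 0 / a"
  have t0: "0 < t0" "t0 < \<delta>" using assms by (auto simp: t0_def)
  have g1_le: "g1 t \<le> g1 0 - a * t" if t: "t \<in> {0..\<delta>}" for t
  proof (cases "t = 0")
    case False
    then obtain \<xi> where \<xi>: "0 < \<xi>" "\<xi> < t" "g1 t - g1 0 = g2 \<xi> * (t - 0)"
      using mvt_within[of "{0..\<delta>}" g1 g2 0 t] D1 t by (metis atLeastAtMost_iff atLeastatMost_subset_iff order.refl order_le_less)
    then have "g2 \<xi> * t \<le> - a * t" using g2[of \<xi>] t by (intro mult_right_mono) auto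
    then show ?thesis using \<xi> by simp
  qed simp
  have g_t0: "g t0 \<le> 0"
  proof -
    let ?u = "\<lambda>t. g t - (g1 0 * t - a * t\<^sup>2 / 2)"
    have "(?u has_real_derivative g1 t - (g1 0 - a * t)) (at t within {0..\<delta>})" if "t \<in> {0..\<delta>}" for t
      using that by (auto intro!: derivative_eq_intros D0)
    then obtain \<xi> where \<xi>: "0 < \<xi>" "\<xi> < t0" "?u t0 - ?u 0 = (g1 \<xi> - (g1 0 - a * \<xi>)) * (t0 - 0)"
      using mvt_within[of "{0..\<delta>}" ?u "\<lambda>t. g1 t - (g1 0 - a * t)" 0 t0] t0 by auto
    have "(g1 \<xi> - (g1 0 - a * \<xi>)) * (t0 - 0) \<le> 0"
      using g1_le[of \<xi>] \<xi> t0 by (intro mult_nonpos_nonneg) auto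
    then have "?u t0 - ?u 0 \<le> 0" unfolding \<xi>(3) .
    moreover have "g1 0 * t0 - a * t0\<^sup>2 / 2 = 0"
      using \<open>a > 0\<close> by (simp add: t0_def power2_eq_square)
    ultimately show ?thesis using \<open>g 0 = 0\<close> by simp
  qed
  \<comment> \<open>Because \<open>g 0 = 0\<close>, the intermediate value theorem must start at a
    time where \<open>g\<close> is already positive, or it could return the trivial zero.\<close>
  obtain d where d: "d > 0" "\<And>h. h > 0 \<Longrightarrow> 0 + h \<in> {0..\<delta>} \<Longrightarrow> h < d \<Longrightarrow> g 0 < g (0 + h)"
    using has_real_derivative_pos_inc_right[OF D0[of 0] \<open>g1 0 > 0\<close>] t0 by auto
  define t1 where "t1 = min (d / 2) t0"
  have t1: "0 < t1" "t1 \<le> t0" "g t1 > 0"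
    using d(2)[of t1] d(1) t0 \<open>g 0 = 0\<close> by (auto simp: t1_def)
  have "continuous_on {0..\<delta>} g"
    using D0 DERIV_continuous continuous_on_eq_continuous_within by metis
  then have "continuous_on {t1..t0} g"
    by (rule continuous_on_subset) (use t0 t1 in auto)
  then obtain T where T: "t1 \<le> T" "T \<le> t0" "g T = 0"
    using IVT2'[of g t0 0 t1] g_t0 t1 by auto
  show thesis
  proof (rule that)
    show "0 < T" "T \<le> 2 * g1 0 / a" "g T = 0" using T t1 by (auto simp: t0_def)
    fix t assume t: "0 < t" "t < T"
    show "g t \<noteq> 0"
    proof
      assume "g t = 0"
      have sub: "{0..t} \<subseteq> {0..\<delta>}" "{t..T} \<subseteq> {0..\<delta>}" using t T t0 by auto
      obtain \<xi>1 where \<xi>1: "0 < \<xi>1" "\<xi>1 < t" "g1 \<xi>1 = 0"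
        using mvt_within[of "{0..\<delta>}" g g1 0 t, OF D0 sub(1) t(1)] \<open>g t = 0\<close> \<open>g 0 = 0\<close> t
        by (metis diff_self mult_eq_0_iff diff_zero less_irrefl)
      obtain \<xi>2 where \<xi>2: "t < \<xi>2" "\<xi>2 < T" "g1 \<xi>2 = 0"
        using mvt_within[of "{0..\<delta>}" g g1 t T, OF D0 sub(2) t(2)] \<open>g t = 0\<close> \<open>g T = 0\<close> t
        by (metis diff_self mult_eq_0_iff eq_iff_diff_eq_0 less_irrefl)
      have "{\<xi>1..\<xi>2} \<subseteq> {0..\<delta>}" "\<xi>1 < \<xi>2" using \<xi>1 \<xi>2 T t0 by auto
      then obtain \<xi> where "\<xi>1 < \<xi>" "\<xi> < \<xi>2" "g2 \<xi> = 0"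
        using mvt_within[of "{0..\<delta>}" g1 g2 \<xi>1 \<xi>2, OF D1] \<xi>1 \<xi>2
        by (metis diff_self mult_eq_0_iff eq_iff_diff_eq_0 less_irrefl)
      then show False using g2[of \<xi>] \<open>a > 0\<close> \<xi>1 \<xi>2 T t0 by auto
    qed
  qed
qed

text \<open>Substituting the return condition into the expansion of \<open>v\<close> cancels the linear terms;
  this is why the sign of the velocity is exactly reversed to first order.\<close>

lemma return_expansion:
  fixes a b w T v B k :: real
  assumes "0 < T" "T \<le> k * w" "T \<le> 1" "\<bar>b\<bar> \<le> B" "a < 0" "2 / \<bar>a\<bar> \<le> k" "0 < w"
    and zero: "\<bar>w * T + a * T\<^sup>2 / 2 + b * T ^ 3 / 6\<bar> \<le> B * T ^ 4"
    and v: "\<bar>v - (w + a * T + b * T\<^sup>2 / 2)\<bar> \<le> B * T ^ 3"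
  shows "\<bar>T + 2 * w / a\<bar> \<le> 2 * B * k ^ 3 * w\<^sup>2"
    and "\<bar>v + w - 2 * b * w\<^sup>2 / (3 * a\<^sup>2)\<bar> \<le> (3 * B * k ^ 3 + 2 * B\<^sup>2 * k ^ 4) * w ^ 3"
proof -
  have "B \<ge> 0" using \<open>\<bar>b\<bar> \<le> B\<close> by linarith
  have "k > 0" using \<open>2 / \<bar>a\<bar> \<le> k\<close> \<open>a < 0\<close> by (smt (verit) divide_pos_pos)
  have T2: "T\<^sup>2 \<le> (k * w)\<^sup>2" and T3: "T ^ 3 \<le> (k * w) ^ 3"
    using assms by (auto intro!: power_mono)
  \<comment> \<open>The trivial zero at time 0 is divided out of the return condition.\<close>
  have e: "\<bar>w + a * T / 2 + b * T\<^sup>2 / 6\<bar> \<le> B * T ^ 3"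
  proof -
    have f1: "w * T + a * T\<^sup>2 / 2 + b * T ^ 3 / 6 = (w + a * T / 2 + b * T\<^sup>2 / 6) * T"
      by (simp add: algebra_simps power2_eq_square power3_eq_cube)
    have f2: "B * T ^ 4 = B * T ^ 3 * T" by (simp add: power_numeral_reduce)
    have "\<bar>w + a * T / 2 + b * T\<^sup>2 / 6\<bar> * T \<le> B * T ^ 3 * T"
      using zero unfolding f1 f2 abs_mult abs_of_pos[OF \<open>0 < T\<close>] .
    then show ?thesis using \<open>0 < T\<close> by simp
  qed
  have bT: "\<bar>b * T\<^sup>2 / 6\<bar> \<le> B * T\<^sup>2"
  proof -
    have "\<bar>b\<bar> * T\<^sup>2 \<le> B * T\<^sup>2" using \<open>\<bar>b\<bar> \<le> B\<close> by (intro mult_right_mono) auto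
    moreover have "0 \<le> B * T\<^sup>2" using \<open>B \<ge> 0\<close> by simp
    ultimately show ?thesis by (simp add: abs_mult)
  qed
  have "B * T ^ 3 \<le> B * T\<^sup>2"
    using \<open>B \<ge> 0\<close> assms by (intro mult_left_mono power_decreasing) auto
  then have lin: "\<bar>w + a * T / 2\<bar> \<le> 2 * B * T\<^sup>2" using e bT by linarith
  have "T + 2 * w / a = (2 / a) * (w + a * T / 2)" using \<open>a < 0\<close> by (simp add: field_simps)
  then have "\<bar>T + 2 * w / a\<bar> = (2 / \<bar>a\<bar>) * \<bar>w + a * T / 2\<bar>"
    by (simp only: abs_mult abs_divide abs_numeral)
  also have "\<dots> \<le> k * (2 * B * T\<^sup>2)"
    using lin \<open>2 / \<bar>a\<bar> \<le> k\<close> \<open>k > 0\<close> by (intro mult_mono) auto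
  also have "\<dots> \<le> k * (2 * B * (k * w)\<^sup>2)"
    using T2 \<open>B \<ge> 0\<close> \<open>k > 0\<close> by (intro mult_left_mono) auto
  also have "\<dots> = 2 * B * k ^ 3 * w\<^sup>2" by (simp add: power2_eq_square power3_eq_cube)
  finally show T: "\<bar>T + 2 * w / a\<bar> \<le> 2 * B * k ^ 3 * w\<^sup>2" .
  \<comment> \<open>The error in the expansion of \<open>v\<close> plus twice the quantity in
    \<open>e\<close>: the terms \<open>a * T\<close> cancel, and the errors add up to the factor
    3.\<close>
  have "\<bar>v + w - b * T\<^sup>2 / 6\<bar> \<le> 3 * (B * T ^ 3)" using e v by linarith
  also have "\<dots> \<le> 3 * (B * (k * w) ^ 3)" using T3 \<open>B \<ge> 0\<close> by (intro mult_left_mono) auto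
  finally have v': "\<bar>v + w - b * T\<^sup>2 / 6\<bar> \<le> 3 * B * k ^ 3 * w ^ 3" by (simp add: power_mult_distrib)
  have "\<bar>2 * w / a\<bar> \<le> k * w"
    using mult_right_mono[OF \<open>2 / \<bar>a\<bar> \<le> k\<close>, of w] \<open>0 < w\<close> by (simp add: abs_mult)
  then have "\<bar>T - 2 * w / a\<bar> \<le> 2 * k * w" using assms by linarith
  then have "\<bar>T + 2 * w / a\<bar> * \<bar>T - 2 * w / a\<bar> \<le> (2 * B * k ^ 3 * w\<^sup>2) * (2 * k * w)"
    using T \<open>B \<ge> 0\<close> \<open>k > 0\<close> by (intro mult_mono) auto
  from mult_mono[OF \<open>\<bar>b\<bar> \<le> B\<close> this \<open>B \<ge> 0\<close>]
  have prod: "\<bar>b\<bar> * (\<bar>T + 2 * w / a\<bar> * \<bar>T - 2 * w / a\<bar>) \<le> B * ((2 * B * k ^ 3 * w\<^sup>2) * (2 * k * w))"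
    by simp
  \<comment> \<open>The two terms agree at \<open>T = - 2 * w / a\<close>. Their gap is a difference
    of squares, with the time error as one factor and a factor of order \<open>w\<close> as the
    other.\<close>
  have diff: "b * T\<^sup>2 / 6 - 2 * b * w\<^sup>2 / (3 * a\<^sup>2) = b * ((T + 2 * w / a) * (T - 2 * w / a)) / 6"
    using \<open>a < 0\<close> by (simp add: field_simps power2_eq_square)
  have sixth: "P / 6 \<le> 2 * Z" if "P \<le> Q" "Q = 4 * Z" "0 \<le> Z" for P Q Z :: real
    using that by simp
  have "B * ((2 * B * k ^ 3 * w\<^sup>2) * (2 * k * w)) = 4 * (B\<^sup>2 * k ^ 4 * w ^ 3)"
    by (simp add: power_numeral_reduce)
  moreover have "B\<^sup>2 * k ^ 4 * w ^ 3 \<ge> 0" using \<open>0 < w\<close> by simp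
  ultimately have "\<bar>b * T\<^sup>2 / 6 - 2 * b * w\<^sup>2 / (3 * a\<^sup>2)\<bar> \<le> 2 * (B\<^sup>2 * k ^ 4 * w ^ 3)"
    unfolding diff abs_mult abs_divide abs_numeral by (rule sixth[OF prod])
  then have "\<bar>v + w - 2 * b * w\<^sup>2 / (3 * a\<^sup>2)\<bar> \<le> 3 * B * k ^ 3 * w ^ 3 + 2 * (B\<^sup>2 * k ^ 4 * w ^ 3)"
    using v' by linarith
  then show "\<bar>v + w - 2 * b * w\<^sup>2 / (3 * a\<^sup>2)\<bar> \<le> (3 * B * k ^ 3 + 2 * B\<^sup>2 * k ^ 4) * w ^ 3"
    by (simp only: distrib_right mult.assoc)
qed

section \<open>Unique returns and bounds on compact sets\<close>

lemma returns_unique: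
  assumes "first_return \<Omega> H f x T y"
    and "\<And>T' y'. first_return \<Omega> H f x T' y' \<Longrightarrow> T' = T \<and> y' = y"
  shows "returns \<Omega> H f x" "return_time \<Omega> H f x = T" "return_point \<Omega> H f x = y"
proof -
  show "returns \<Omega> H f x"
    unfolding returns_def
  proof (rule ex1I[of _ "(T, y)"])
    fix p assume "first_return \<Omega> H f x (fst p) (snd p)"
    from assms(2)[OF this] show "p = (T, y)" by (simp add: prod_eq_iff)
  qed (use assms(1) in simp)
  show "return_time \<Omega> H f x = T" "return_point \<Omega> H f x = y"
    unfolding return_time_def return_point_def
    by (rule the_equality; use assms in blast)+
qed

lemma compact_uniformly_negative:
  fixes g :: "'a::topological_space \<Rightarrow> real"
  assumes "compact K" "continuous_on K g" "\<And>x. x \<in> K \<Longrightarrow> g x < 0"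
  obtains a where "a > 0" "\<And>x. x \<in> K \<Longrightarrow> g x \<le> - a"
proof (cases "K = {}")
  case False
  then obtain m where "m \<in> K" "\<And>x. x \<in> K \<Longrightarrow> g x \<le> g m"
    using continuous_attains_sup[OF assms(1) _ assms(2)] by auto
  then show thesis using that[of "- g m"] assms(3)[of m] by simp
qed (use that[of 1] in simp)

lemma compact_bounded_image:
  fixes g :: "'a::topological_space \<Rightarrow> 'b::real_normed_vector"
  assumes "compact K" "continuous_on K g"
  obtains B where "B > 0" "\<And>x. x \<in> K \<Longrightarrow> norm (g x) \<le> B"
  using compact_imp_bounded[OF compact_continuous_image[OF assms(2,1)]]
  by (auto simp: bounded_pos)

section \<open>One-sided return maps\<close>

lemma open_Collect_less_on:
  fixes g :: "'a::topological_space \<Rightarrow> real"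
  assumes "open \<Omega>" "continuous_on \<Omega> g"
  shows "open {x \<in> \<Omega>. g x < c}"
proof -
  have "open (\<Omega> \<inter> g -` {..<c})"
    by (rule continuous_open_preimage[OF assms(2,1)]) simp
  moreover have "\<Omega> \<inter> g -` {..<c} = {x \<in> \<Omega>. g x < c}" by auto
  ultimately show ?thesis by simp
qed

text \<open>The radius is halved so that every point within \<open>r\<close> of \<open>S\<close> has
  a full ball of radius \<open>r\<close> inside one compact set. Orbits are confined to such balls,
  and constants are chosen on the compact set.\<close>

lemma compact_cball_neighbourhood:
  fixes S :: "'a::euclidean_space set"
  assumes "compact S" "open \<Omega>" "S \<subseteq> \<Omega>"
  obtains r where "r > 0" "compact (\<Union>x\<in>S. cball x (2 * r))" "(\<Union>x\<in>S. cball x (2 * r)) \<subseteq> \<Omega>"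
    "\<And>s x. s \<in> S \<Longrightarrow> x \<in> ball s r \<Longrightarrow> cball x r \<subseteq> (\<Union>x\<in>S. cball x (2 * r))"
proof -
  obtain e where e: "e > 0" "(\<Union>x\<in>S. cball x e) \<subseteq> \<Omega>"
    using compact_subset_open_imp_cball_epsilon_subset[OF assms] by blast
  have "compact (\<Union>x\<in>S. cball x e)"
    using assms(1) by (rule compact_minkowski_sum_cball)
  then show thesis
  proof (intro that[of "e / 2"])
    fix s x assume "s \<in> S" "x \<in> ball s (e / 2)"
    moreover have "dist s y \<le> e" if "dist s x < e / 2" "dist x y \<le> e / 2" for y
      using dist_triangle[of s y x] that by linarith
    ultimately show "cball x (e / 2) \<subseteq> (\<Union>x\<in>S. cball x (2 * (e / 2)))" by fastforce
  qed (use e in simp_all)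
qed

text \<open>Only the given return \<open>T\<close> has to be short. A rival solution agrees with it
  on \<open>{0..min T T'}\<close>, so if one return were earlier, the other orbit would hit the
  surface before its own first return.\<close>

lemma first_return_unique:
  fixes f :: "'a::euclidean_space \<Rightarrow> 'a"
  assumes lip: "\<And>y z. y \<in> cball x r \<Longrightarrow> z \<in> cball x r \<Longrightarrow> norm (f y - f z) \<le> L * norm (y - z)"
    and M: "\<And>z. z \<in> cball x r \<Longrightarrow> norm (f z) \<le> M"
    and bds: "L \<ge> 0" "L * T < 1" "M * T < r" "r > 0"
    and T: "first_return \<Omega> H f x T y" and T': "first_return \<Omega> H f x T' y'"
  shows "T' = T \<and> y' = y"
proof -
  obtain \<phi> where \<phi>: "solution_on \<Omega> f x T \<phi>" "\<phi> T = y" "y \<in> disc_surface \<Omega> H" "T > 0"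
    "\<And>t. 0 < t \<Longrightarrow> t < T \<Longrightarrow> \<phi> t \<notin> disc_surface \<Omega> H"
    using T unfolding first_return_def by blast
  obtain \<psi> where \<psi>: "solution_on \<Omega> f x T' \<psi>" "\<psi> T' = y'" "y' \<in> disc_surface \<Omega> H" "T' > 0"
    "\<And>t. 0 < t \<Longrightarrow> t < T' \<Longrightarrow> \<psi> t \<notin> disc_surface \<Omega> H"
    using T' unfolding first_return_def by blast
  let ?m = "min T T'"
  have "M \<ge> 0" using order_trans[OF norm_ge_zero M[of x]] bds by simp
  then have "M * ?m \<le> M * T" "L * ?m \<le> L * T" using bds by (auto intro!: mult_left_mono)
  then have m: "M * ?m < r" "L * ?m < 1" using bds by auto
  have sol: "solution_on \<Omega> f x ?m \<phi>" "solution_on \<Omega> f x ?m \<psi>"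
    using solution_on_subinterval[OF \<phi>(1)] solution_on_subinterval[OF \<psi>(1)] by auto
  have "\<phi> ?m = \<psi> ?m"
    by (rule solution_on_unique[OF sol solution_on_in_cball[OF sol(1) M m(1) bds(4)]
          solution_on_in_cball[OF sol(2) M m(1) bds(4)] lip bds(1) m(2)])
      (use \<phi>(4) \<psi>(4) in auto)
  then show ?thesis
    using \<phi> \<psi> by (cases T T' rule: linorder_cases) auto
qed

text \<open>One passage in the normalised sign pattern \<open>a < 0 < w\<close>, so the leading
  return time is \<open>- 2 * w / a\<close>. The coarse bound on \<open>norm (y - x)\<close> serves
  to compare coefficients at \<open>y\<close> and \<open>x\<close> when passages are
  composed.\<close>

definition return_bounds ::
  "'a::real_inner set \<Rightarrow> ('a \<Rightarrow> real) \<Rightarrow> ('a \<Rightarrow> 'a) \<Rightarrow> real \<Rightarrow> 'a \<Rightarrow> bool" where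
  "return_bounds \<Omega> H f C x \<longleftrightarrow>
    (let w = lie f 1 H x; a = lie f 2 H x; b = lie f 3 H x;
         T = return_time \<Omega> H f x; y = return_point \<Omega> H f x
     in returns \<Omega> H f x \<and> y \<in> disc_surface \<Omega> H \<and> norm (y - x) \<le> C * w \<and>
        \<bar>T + 2 * w / a\<bar> \<le> C * w\<^sup>2 \<and>
        norm (y - x + (2 * w / a) *\<^sub>R f x) \<le> C * w\<^sup>2 \<and>
        \<bar>lie f 1 H y + w - 2 * b * w\<^sup>2 / (3 * a\<^sup>2)\<bar> \<le> C * w ^ 3)"

lemma return_asymptotics:
  fixes H :: "'a::euclidean_space \<Rightarrow> real"
  assumes "open \<Omega>" and H: "Ck_on (Suc 3) H \<Omega>" and f: "Ck_on 3 f \<Omega>"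
    and S: "compact S" "S \<subseteq> \<Omega>"
    and S1: "\<And>x. x \<in> S \<Longrightarrow> lie f 1 H x = 0" and S2: "\<And>x. x \<in> S \<Longrightarrow> lie f 2 H x < 0"
  obtains N C where "open N" "S \<subseteq> N" "N \<subseteq> \<Omega>" "C \<ge> 0" "\<forall>x\<in>N. lie f 2 H x < 0"
    "\<forall>x\<in>N. H x = 0 \<longrightarrow> lie f 1 H x > 0 \<longrightarrow> return_bounds \<Omega> H f C x"
proof -
  have cont: "continuous_on \<Omega> (lie f m H)" if "m \<le> Suc 3" for m
    by (rule Ck_on_imp_continuous_on[OF Ck_on_lie[OF \<open>open \<Omega>\<close> H f that]])
  \<comment> \<open>Concavity must hold along the whole orbit, hence the compact neighbourhood is
    taken where the second Lie derivative is negative.\<close>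
  define \<Omega>' where "\<Omega>' = {x \<in> \<Omega>. lie f 2 H x < 0}"
  have "open \<Omega>'" unfolding \<Omega>'_def using cont by (intro open_Collect_less_on \<open>open \<Omega>\<close>) simp
  moreover have "S \<subseteq> \<Omega>'" using S S2 by (auto simp: \<Omega>'_def)
  ultimately obtain r where r: "r > 0" "compact (\<Union>x\<in>S. cball x (2 * r))"
      "(\<Union>x\<in>S. cball x (2 * r)) \<subseteq> \<Omega>'"
      "\<And>s x. s \<in> S \<Longrightarrow> x \<in> ball s r \<Longrightarrow> cball x r \<subseteq> (\<Union>x\<in>S. cball x (2 * r))"
    using compact_cball_neighbourhood[OF S(1)] by metis
  define K where "K = (\<Union>x\<in>S. cball x (2 * r))"
  have K: "compact K" "K \<subseteq> \<Omega>'" "K \<subseteq> \<Omega>" using r by (auto simp: K_def \<Omega>'_def)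
  have contK: "continuous_on K (lie f m H)" if "m \<le> Suc 3" for m
    using cont[OF that] K(3) by (rule continuous_on_subset)
  obtain a where a: "a > 0" "\<And>x. x \<in> K \<Longrightarrow> lie f 2 H x \<le> - a"
    using compact_uniformly_negative[OF K(1) contK[of 2]] K(2) by (auto simp: \<Omega>'_def)
  obtain B3 where B3: "B3 > 0" "\<And>x. x \<in> K \<Longrightarrow> norm (lie f 3 H x) \<le> B3"
    using compact_bounded_image[OF K(1) contK[of 3]] by auto
  obtain B4 where B4: "B4 > 0" "\<And>x. x \<in> K \<Longrightarrow> norm (lie f 4 H x) \<le> B4"
    using compact_bounded_image[OF K(1) contK[of 4]] by auto
  obtain M where M: "M > 0" "\<And>x. x \<in> K \<Longrightarrow> norm (f x) \<le> M"
    using compact_bounded_image[OF K(1) continuous_on_subset[OF Ck_on_imp_continuous_on[OF f] K(3)]]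
    by auto
  obtain L where L: "L \<ge> 0" "\<And>x y. closed_segment x y \<subseteq> K \<Longrightarrow> norm (f x - f y) \<le> L * norm (x - y)"
    using C1_lipschitz_on_compact[OF Ck_on_le[OF f] K(1,3)] by auto
  define B where "B = max B3 B4"
  have B: "B \<ge> 0" "\<And>x. x \<in> K \<Longrightarrow> \<bar>lie f 3 H x\<bar> \<le> B" "\<And>x. x \<in> K \<Longrightarrow> \<bar>lie f 4 H x\<bar> \<le> B"
    using B3 B4 by (fastforce simp: B_def)+
  \<comment> \<open>Short enough for existence and uniqueness (\<open>L * \<delta> < 1\<close>) and
    for confinement (\<open>M * \<delta> < r\<close>). The \<open>+ 1\<close> covers
    \<open>L = 0\<close> and also yields \<open>\<delta> \<le> 1\<close>.\<close>
  define \<delta> where "\<delta> = min (1 / (2 * (L + 1))) (r / (2 * M))"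
  have \<delta>: "\<delta> > 0" "\<delta> \<le> 1" "L * \<delta> < 1" "M * \<delta> < r"
  proof -
    show "\<delta> > 0" using L M r by (simp add: \<delta>_def)
    have "\<delta> \<le> 1 / (2 * (L + 1))" "\<delta> \<le> r / (2 * M)" by (simp_all add: \<delta>_def)
    then have "2 * (L + 1) * \<delta> \<le> 1" "2 * M * \<delta> \<le> r"
      using L M by (simp_all add: field_simps)
    moreover have "L * \<delta> \<ge> 0" "M * \<delta> > 0" using L M \<open>\<delta> > 0\<close> by simp_all
    ultimately show "\<delta> \<le> 1" "L * \<delta> < 1" "M * \<delta> < r"
      using \<open>\<delta> > 0\<close> r by (simp_all add: algebra_simps)
  qed
  define k where "k = 2 / a"
  have "k > 0" using a by (simp add: k_def)
  \<comment> \<open>The velocity bound says \<open>2 * w / a < \<delta>\<close>: the return falls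
    within the lifetime of the local solution.\<close>
  define N where "N = (\<Union>s\<in>S. ball s r) \<inter> {x \<in> \<Omega>. lie f 1 H x < a * \<delta> / 2}"
  \<comment> \<open>The sum of the nonnegative constants for displacement, time, point and velocity;
    it dominates each of them.\<close>
  define C where "C = M * k + 2 * B * k ^ 3 + (L * M * k\<^sup>2 + M * (2 * B * k ^ 3))
    + (3 * B * k ^ 3 + 2 * B\<^sup>2 * k ^ 4)"
  have C: "M * k \<le> C" "2 * B * k ^ 3 \<le> C" "L * M * k\<^sup>2 + M * (2 * B * k ^ 3) \<le> C"
      "3 * B * k ^ 3 + 2 * B\<^sup>2 * k ^ 4 \<le> C" "0 \<le> C"
    using M(1) \<open>k > 0\<close> B(1) L(1) by (simp_all add: C_def)
  show thesis
  proof (rule that[of N C])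
    show "open N"
      unfolding N_def using cont[of 1]
      by (intro open_Int open_UN ballI open_ball open_Collect_less_on \<open>open \<Omega>\<close>) simp
    show "S \<subseteq> N"
    proof
      fix s assume "s \<in> S"
      then show "s \<in> N" using S1[of s] S(2) a(1) \<delta>(1) r(1) unfolding N_def by fastforce
    qed
    show "N \<subseteq> \<Omega>" by (auto simp: N_def)
    show "C \<ge> 0" by (rule C)
    have NK: "cball x r \<subseteq> K" if "x \<in> N" for x using r(4) that by (auto simp: N_def K_def)
    have NK': "x \<in> K" if "x \<in> N" for x using NK[OF that] r(1) by auto
    show "\<forall>x\<in>N. lie f 2 H x < 0" using a(2)[OF NK'] a(1) by force
    show "\<forall>x\<in>N. H x = 0 \<longrightarrow> lie f 1 H x > 0 \<longrightarrow> return_bounds \<Omega> H f C x"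
    proof (intro ballI impI)
      fix x assume x: "x \<in> N" "H x = 0" and "lie f 1 H x > 0"
      define w where "w = lie f 1 H x"
      have w: "w = lie f 1 H x" "w > 0" using \<open>lie f 1 H x > 0\<close> by (simp_all only: w_def)
      define y where "y = return_point \<Omega> H f x"
      have lip: "norm (f u - f v) \<le> L * norm (u - v)" if "u \<in> cball x r" "v \<in> cball x r" for u v
        by (rule L(2)) (use closed_segment_subset[OF that convex_cball] NK[OF x(1)] in blast)
      have Mx: "norm (f u) \<le> M" if "u \<in> cball x r" for u using M(2) NK[OF x(1)] that by blast
      obtain \<phi> where \<phi>: "solution_on (cball x r) f x \<delta> \<phi>"
        using local_solution_exists[OF lip Mx L(1) \<delta>(3) _ \<delta>(4) r(1)] \<delta>(1) by auto
      have \<phi>K: "\<phi> t \<in> K" and \<phi>\<Omega>: "\<phi> t \<in> \<Omega>" and \<phi>b: "\<phi> t \<in> cball x r"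
        and \<phi>': "(\<phi> has_vector_derivative f (\<phi> t)) (at t within {0..\<delta>})" if "t \<in> {0..\<delta>}" for t
        using \<phi> that NK[OF x(1)] K(3) unfolding solution_on_def by blast+
      have \<phi>0: "\<phi> 0 = x" using \<phi> by (simp add: solution_on_def)
      define h where "h = (\<lambda>m t. lie f m H (\<phi> t))"
      have D: "(h m has_real_derivative h (Suc m) t) (at t within {0..\<delta>})"
        if "m \<le> 3" "t \<in> {0..\<delta>}" for m t
        unfolding h_def
        by (rule lie_along_solution[OF \<open>open \<Omega>\<close> H f that(1) \<phi>\<Omega>[OF that(2)] \<phi>'[OF that(2)]])
      have nums: "Suc 0 = 1" "Suc 1 = 2" by simp_all
      have h0: "h 0 0 = 0" using x(2) by (simp add: h_def \<phi>0)
      have h1: "h 1 0 = w" by (simp only: h_def \<phi>0 w)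
      have wk: "2 * w / a < \<delta>" using x(1) w(1) a(1) by (simp add: N_def field_simps)
      obtain \<tau> where \<tau>: "0 < \<tau>" "\<tau> \<le> 2 * w / a" "h 0 \<tau> = 0" "\<And>t. 0 < t \<Longrightarrow> t < \<tau> \<Longrightarrow> h 0 t \<noteq> 0"
      proof (rule concave_first_zero[of \<delta> "h 0" "h 1" "h 2" a, unfolded h1])
        show "(h 0 has_real_derivative h 1 t) (at t within {0..\<delta>})" if "t \<in> {0..\<delta>}" for t
          using D[of 0 t] that unfolding nums by simp
        show "(h 1 has_real_derivative h 2 t) (at t within {0..\<delta>})" if "t \<in> {0..\<delta>}" for t
          using D[of 1 t, unfolded nums] that by simp
        show "h 2 t \<le> - a" if "t \<in> {0..\<delta>}" for t
          using a(2)[OF \<phi>K[OF that]] by (simp only: h_def)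
      qed (use a(1) h0 w(2) wk in auto)
      have \<tau>\<delta>: "\<tau> < \<delta>" "\<tau> \<in> {0..\<delta>}" "\<tau> \<le> k * w" "\<tau> \<le> 1"
        using \<tau>(1,2) wk \<delta>(2) by (simp_all add: k_def)
      have ret: "first_return \<Omega> H f x \<tau> (\<phi> \<tau>)"
        unfolding first_return_def
      proof (intro conjI exI[of _ \<phi>] allI impI)
        have "solution_on \<Omega> f x \<delta> \<phi>" using \<phi>0 \<phi>\<Omega> \<phi>' by (simp add: solution_on_def)
        then show "solution_on \<Omega> f x \<tau> \<phi>" by (rule solution_on_subinterval) (use \<tau>\<delta>(1) in simp)
        show "\<phi> \<tau> \<in> disc_surface \<Omega> H" using \<phi>\<Omega>[OF \<tau>\<delta>(2)] \<tau>(3) by (simp add: disc_surface_def h_def)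
        show "\<phi> t \<notin> disc_surface \<Omega> H" if "0 < t \<and> t < \<tau>" for t
          using \<tau>(4)[of t] that by (simp add: disc_surface_def h_def)
      qed (use \<tau> in auto)
      have "L * \<tau> \<le> L * \<delta>" "M * \<tau> \<le> M * \<delta>"
        using \<tau>\<delta>(1) L(1) M(1) by (intro mult_left_mono; simp)+
      then have L\<tau>: "L * \<tau> < 1" and M\<tau>: "M * \<tau> < r" using \<delta>(3,4) by linarith+
      \<comment> \<open>The rival solution may live anywhere in \<open>\<Omega>\<close>; shortness
        of \<open>\<tau>\<close> alone excludes it.\<close>
      have "T' = \<tau> \<and> y' = \<phi> \<tau>" if "first_return \<Omega> H f x T' y'" for T' y'
        by (rule first_return_unique[OF lip Mx L(1) L\<tau> M\<tau> r(1) ret that])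
      note R = returns_unique[OF ret this]
      have T: "return_time \<Omega> H f x = \<tau>" by (rule R(2))
      have y: "y = \<phi> \<tau>" unfolding y_def by (rule R(3))
      have abs_h4: "\<bar>h 4 t\<bar> \<le> B" if "t \<in> {0..\<delta>}" for t
        using B(3)[OF \<phi>K[OF that]] by (simp only: h_def)
      note taylor = taylor_bounds[of \<delta> h B \<tau>, OF D abs_h4 \<tau>\<delta>(2), unfolded h0 h1 \<tau>(3)]
      define a' b where "a' = lie f 2 H x" and "b = lie f 3 H x"
      have h23: "h 2 0 = a'" "h 3 0 = b" by (simp_all only: h_def \<phi>0 a'_def b_def)
      have v: "h 1 \<tau> = lie f 1 H y" by (simp only: h_def y)
      have zero: "\<bar>w * \<tau> + a' * \<tau>\<^sup>2 / 2 + b * \<tau> ^ 3 / 6\<bar> \<le> B * \<tau> ^ 4"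
        using taylor(1) unfolding h23 by linarith
      have a': "a' \<le> - a" "\<bar>b\<bar> \<le> B" using a(2) B(2) NK'[OF x(1)] by (simp_all add: a'_def b_def)
      then have "a' < 0" "2 / \<bar>a'\<bar> \<le> k"
        unfolding k_def using a(1) by (simp, intro frac_le) auto
      note asym = return_expansion[OF \<tau>(1) \<tau>\<delta>(3,4) a'(2) this w(2) zero taylor(2)[unfolded h23 v]]
      have near: "norm (\<phi> t - x) \<le> M * t" if t: "t \<in> {0..\<tau>}" for t
      proof -
        have "norm (\<phi> t - \<phi> 0) \<le> M * (t - 0)"
        proof (rule vector_derivative_bound_interval)
          fix s assume "s \<in> {0..t}"
          then have s: "s \<in> {0..\<delta>}" using t \<tau>\<delta>(1) by auto
          show "(\<phi> has_vector_derivative f (\<phi> s)) (at s within {0..t})"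
            by (rule has_vector_derivative_within_subset[OF \<phi>'[OF s]]) (use t \<tau>\<delta>(1) in auto)
          show "norm (f (\<phi> s)) \<le> M" by (rule Mx[OF \<phi>b[OF s]])
        qed (use t in auto)
        then show ?thesis by (simp add: \<phi>0)
      qed
      have "norm (y - x) \<le> M * k * w"
        unfolding y mult.assoc using \<tau>(1) M(1)
        by (intro order_trans[OF near[of \<tau>] mult_left_mono[OF \<tau>\<delta>(3)]]) simp_all
      \<comment> \<open>The deviation from the straight line has derivative
        \<open>f (\<phi> s) - f x\<close>, of size at most \<open>L * M * \<tau>\<close>, so it is
        of second order in \<open>\<tau>\<close>.\<close>
      have "norm ((\<phi> \<tau> - \<tau> *\<^sub>R f x) - (\<phi> 0 - 0 *\<^sub>R f x)) \<le> (L * (M * \<tau>)) * (\<tau> - 0)"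
      proof (rule vector_derivative_bound_interval)
        fix s assume s\<tau>: "s \<in> {0..\<tau>}"
        then have s: "s \<in> {0..\<delta>}" using \<tau>\<delta>(1) by auto
        have "(\<phi> has_vector_derivative f (\<phi> s)) (at s within {0..\<tau>})"
          by (rule has_vector_derivative_within_subset[OF \<phi>'[OF s]]) (use \<tau>\<delta>(1) in auto)
        then show "((\<lambda>t. \<phi> t - t *\<^sub>R f x) has_vector_derivative f (\<phi> s) - f x) (at s within {0..\<tau>})"
          by (auto intro!: derivative_eq_intros)
        have "M * s \<le> M * \<tau>" using s\<tau> M(1) by (intro mult_left_mono) auto
        note near' = order_trans[OF near[OF s\<tau>] this]
        have "norm (f (\<phi> s) - f x) \<le> L * norm (\<phi> s - x)"
          using lip[OF \<phi>b[OF s], of x] r(1) by simp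
        also have "\<dots> \<le> L * (M * \<tau>)"
          by (rule mult_left_mono[OF near' L(1)])
        finally show "norm (f (\<phi> s) - f x) \<le> L * (M * \<tau>)" .
      qed (use \<tau>(1) in simp)
      then have "norm (y - x - \<tau> *\<^sub>R f x) \<le> L * M * \<tau>\<^sup>2"
        by (simp add: \<phi>0 y power2_eq_square algebra_simps)
      also have "\<dots> \<le> L * M * (k * w)\<^sup>2"
        using \<tau>(1) \<tau>\<delta>(3) L(1) M(1) by (intro mult_left_mono power_mono) auto
      finally have y1: "norm (y - x - \<tau> *\<^sub>R f x) \<le> L * M * k\<^sup>2 * w\<^sup>2"
        by (simp add: power_mult_distrib mult.assoc)
      \<comment> \<open>Replacing \<open>\<tau>\<close> by its leading term costs the time error
        times the speed bound \<open>M\<close>.\<close>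
      have "norm ((\<tau> + 2 * w / a') *\<^sub>R f x) \<le> (2 * B * k ^ 3 * w\<^sup>2) * M"
        unfolding norm_scaleR real_norm_def
        using asym(1) Mx[of x] r(1) B(1) \<open>k > 0\<close> by (intro mult_mono) auto
      then have "norm ((y - x - \<tau> *\<^sub>R f x) + (\<tau> + 2 * w / a') *\<^sub>R f x)
          \<le> L * M * k\<^sup>2 * w\<^sup>2 + (2 * B * k ^ 3 * w\<^sup>2) * M"
        by (rule norm_triangle_mono[OF y1])
      then have y2: "norm (y - x + (2 * w / a') *\<^sub>R f x) \<le> (L * M * k\<^sup>2 + M * (2 * B * k ^ 3)) * w\<^sup>2"
        by (simp add: algebra_simps)
      have up: "c * w ^ m \<le> C * w ^ m" if "c \<le> C" for c m
        using that w(2) by (intro mult_right_mono) auto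
      show "return_bounds \<Omega> H f C x"
        unfolding return_bounds_def Let_def a'_def[symmetric] b_def[symmetric] w_def[symmetric]
          y_def[symmetric]
      proof (intro conjI)
        show "returns \<Omega> H f x" by (rule R)
        show "y \<in> disc_surface \<Omega> H" using ret y by (auto simp: first_return_def)
        show "norm (y - x) \<le> C * w"
          using \<open>norm (y - x) \<le> M * k * w\<close> up[OF C(1), of 1] by simp
        show "\<bar>return_time \<Omega> H f x + 2 * w / a'\<bar> \<le> C * w\<^sup>2"
          unfolding T by (rule order_trans[OF asym(1) up[OF C(2)]])
        show "norm (y - x + (2 * w / a') *\<^sub>R f x) \<le> C * w\<^sup>2" by (rule order_trans[OF y2 up[OF C(3)]])
        show "\<bar>lie f 1 H y + w - 2 * b * w\<^sup>2 / (3 * a'\<^sup>2)\<bar> \<le> C * w ^ 3"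
          by (rule order_trans[OF asym(2) up[OF C(4)]])
      qed
    qed
  qed
qed

section \<open>Composition of the two passages\<close>

lemma bigo_power_mult:
  fixes w :: "'x \<Rightarrow> real"
  assumes "f \<in> O[F](\<lambda>x. w x ^ m)" "g \<in> O[F](\<lambda>x. w x ^ n)"
  shows "(\<lambda>x. f x * g x) \<in> O[F](\<lambda>x. w x ^ (m + n))"
  using landau_o.big.mult[OF assms] by (simp only: power_add)

text \<open>The filter does not force \<open>w\<close> to zero, so lowering the exponent rests on
  boundedness of \<open>w\<close>.\<close>

lemma bigo_power_antimono:
  fixes w :: "'x \<Rightarrow> real"
  assumes w: "w \<in> O[F](\<lambda>_. 1)" and f: "f \<in> O[F](\<lambda>x. w x ^ n)" and "m \<le> n"
  shows "f \<in> O[F](\<lambda>x. w x ^ m)"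
proof -
  have "(\<lambda>x. w x ^ (n - m)) \<in> O[F](\<lambda>_. 1 ^ (n - m))"
    using w by (rule landau_o.big_power)
  then have "(\<lambda>x. w x ^ m * w x ^ (n - m)) \<in> O[F](\<lambda>x. w x ^ m * 1)"
    by (intro landau_o.big.mult landau_o.big_refl) simp
  then have "(\<lambda>x. w x ^ n) \<in> O[F](\<lambda>x. w x ^ m)"
    using \<open>m \<le> n\<close> by (simp flip: power_add)
  with f show ?thesis by (rule landau_o.big_trans)
qed

lemma bigo_norm_bound:
  fixes f g :: "'x \<Rightarrow> real"
  assumes "g \<in> O[F](h)" "\<And>x. \<bar>f x\<bar> \<le> \<bar>g x\<bar>"
  shows "f \<in> O[F](h)"
  by (rule landau_o.big_trans[OF _ assms(1)]) (auto intro!: bigoI[where c = 1] always_eventually assms(2))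

text \<open>Over a principal filter the Landau symbol is a bound on all of \<open>D\<close> with one
  constant, exactly the uniformity that the theorem demands.\<close>

lemma bigo_principal_iff:
  fixes f g :: "'x \<Rightarrow> real"
  shows "f \<in> O[principal D](g) \<longleftrightarrow> (\<exists>C. \<forall>x\<in>D. \<bar>f x\<bar> \<le> C * \<bar>g x\<bar>)"
proof
  assume "f \<in> O[principal D](g)"
  then obtain C where "\<forall>x\<in>D. norm (f x) \<le> C * norm (g x)"
    by (rule landau_o.bigE) (auto simp: eventually_principal)
  then show "\<exists>C. \<forall>x\<in>D. \<bar>f x\<bar> \<le> C * \<bar>g x\<bar>" by auto
next
  assume "\<exists>C. \<forall>x\<in>D. \<bar>f x\<bar> \<le> C * \<bar>g x\<bar>"
  then obtain C where "\<forall>x\<in>D. norm (f x) \<le> C * norm (g x)" by auto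
  then show "f \<in> O[principal D](g)"
    by (intro bigoI[of f C]) (simp add: eventually_principal)
qed

text \<open>Reciprocals of second Lie derivatives enter as \<open>iL\<close>, \<open>iR\<close>; primes mark values at the
  intermediate point \<open>y\<close>, and \<open>w'\<close> is minus the velocity there.\<close>

lemma composed_expansion:
  fixes w w' iL iL' iR bL bL' bR tL tR v :: "'x \<Rightarrow> real"
    and p y z eL eL' eR :: "'x \<Rightarrow> 'a::real_normed_vector"
  assumes w: "w \<in> O[F](\<lambda>_. 1)"
    and bounded: "iL \<in> O[F](\<lambda>_. 1)" "iL' \<in> O[F](\<lambda>_. 1)" "bL \<in> O[F](\<lambda>_. 1)"
      "(\<lambda>x. bR x * (iR x)\<^sup>2) \<in> O[F](\<lambda>_. 1)" "(\<lambda>x. norm (eL x)) \<in> O[F](\<lambda>_. 1)"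
    and iL': "(\<lambda>x. iL' x - iL x) \<in> O[F](w)"
    and bL': "(\<lambda>x. bL' x - bL x) \<in> O[F](w)"
    and eL': "(\<lambda>x. norm (eL' x - eL x)) \<in> O[F](w)"
    and tR: "(\<lambda>x. tR x + 2 * w x * iR x) \<in> O[F](\<lambda>x. w x ^ 2)"
    and y: "(\<lambda>x. norm (y x - p x + (2 * w x * iR x) *\<^sub>R eR x)) \<in> O[F](\<lambda>x. w x ^ 2)"
    and w': "(\<lambda>x. w' x - w x + 2 / 3 * (bR x * (iR x)\<^sup>2) * (w x)\<^sup>2) \<in> O[F](\<lambda>x. w x ^ 3)"
    and tL: "(\<lambda>x. tL x - 2 * w' x * iL' x) \<in> O[F](\<lambda>x. w' x ^ 2)"
    and z: "(\<lambda>x. norm (z x - y x - (2 * w' x * iL' x) *\<^sub>R eL' x)) \<in> O[F](\<lambda>x. w' x ^ 2)"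
    and v: "(\<lambda>x. v x - w' x - 2 / 3 * (bL' x * (iL' x)\<^sup>2) * (w' x)\<^sup>2) \<in> O[F](\<lambda>x. w' x ^ 3)"
  shows "(\<lambda>x. tL x + tR x - 2 * (iL x - iR x) * w x) \<in> O[F](\<lambda>x. w x ^ 2)"
    and "(\<lambda>x. norm (z x - (p x + (2 * w x) *\<^sub>R (iL x *\<^sub>R eL x - iR x *\<^sub>R eR x)))) \<in> O[F](\<lambda>x. w x ^ 2)"
    and "(\<lambda>x. v x - (w x + 2 / 3 * (bL x * (iL x)\<^sup>2 - bR x * (iR x)\<^sup>2) * (w x)\<^sup>2)) \<in> O[F](\<lambda>x. w x ^ 3)"
proof -
  define Q where "Q m = O[F](\<lambda>x. w x ^ m)" for m
  have Q0: "f \<in> O[F](\<lambda>_. 1) \<Longrightarrow> f \<in> Q 0" for f by (simp add: Q_def)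
  have Q1: "f \<in> O[F](w) \<Longrightarrow> f \<in> Q 1" for f by (simp add: Q_def)
  have mult: "(\<lambda>x. f x * g x) \<in> Q n" if "f \<in> Q k" "g \<in> Q m" "n = k + m" for f g k m n
    using that bigo_power_mult unfolding Q_def by blast
  have const: "(\<lambda>_. c) \<in> Q 0" for c by (rule Q0) simp
  have scale: "(\<lambda>x. c * f x) \<in> Q n" if "f \<in> Q n" for c f n
    by (rule mult[OF const that]) simp
  have add: "(\<lambda>x. f x + g x) \<in> Q n" "(\<lambda>x. f x - g x) \<in> Q n" if "f \<in> Q n" "g \<in> Q n" for f g n
    using that sum_in_bigo unfolding Q_def by blast+
  have lower: "f \<in> Q m" if "f \<in> Q n" "m \<le> n" for f m n
    using bigo_power_antimono[OF w] that unfolding Q_def by blast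
  have wQ: "w \<in> Q 1" by (rule Q1) simp
  have w2: "(\<lambda>x. (w x)\<^sup>2) \<in> Q 2" by (simp add: Q_def)
  \<comment> \<open>The speeds before and after the first passage agree to first order, so errors in
    powers of \<open>w'\<close> are errors in powers of \<open>w\<close>.\<close>
  have dw: "(\<lambda>x. w' x - w x) \<in> Q 2"
  proof -
    have "(\<lambda>x. 2 / 3 * (bR x * (iR x)\<^sup>2)) \<in> Q 0" by (intro scale Q0 bounded)
    then have "(\<lambda>x. 2 / 3 * (bR x * (iR x)\<^sup>2) * (w x)\<^sup>2) \<in> Q 2" by (rule mult[OF _ w2]) simp
    moreover have "(\<lambda>x. w' x - w x + 2 / 3 * (bR x * (iR x)\<^sup>2) * (w x)\<^sup>2) \<in> Q 2"
      by (rule lower[of _ 3]) (use w' in \<open>simp_all add: Q_def\<close>)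
    ultimately show ?thesis using add(2) by fastforce
  qed
  have w'Q: "w' \<in> Q 1"
    using add(1)[OF lower[OF dw, of 1] wQ] by simp
  have up: "f \<in> Q m" if "f \<in> O[F](\<lambda>x. w' x ^ m)" for f m
  proof -
    have "w' \<in> O[F](w)" using w'Q by (simp add: Q_def)
    then have "(\<lambda>x. w' x ^ m) \<in> O[F](\<lambda>x. w x ^ m)" by (rule landau_o.big_power)
    with that show ?thesis unfolding Q_def by (rule landau_o.big_trans)
  qed
  \<comment> \<open>Telescoping: coefficient and velocity are replaced one at a time, each change
    costing one order.\<close>
  have di: "(\<lambda>x. w' x * iL' x - w x * iL x) \<in> Q 2"
  proof -
    have "(\<lambda>x. w' x * (iL' x - iL x)) \<in> Q 2" by (rule mult[OF w'Q Q1[OF iL']]) simp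
    moreover have "(\<lambda>x. (w' x - w x) * iL x) \<in> Q 2" by (rule mult[OF dw Q0[OF bounded(1)]]) simp
    ultimately have "(\<lambda>x. w' x * (iL' x - iL x) + (w' x - w x) * iL x) \<in> Q 2" by (rule add(1))
    then show ?thesis by (simp add: algebra_simps)
  qed
  have "(\<lambda>x. (tL x - 2 * w' x * iL' x) + (tR x + 2 * w x * iR x) + 2 * (w' x * iL' x - w x * iL x)) \<in> Q 2"
    by (rule add(1)[OF add(1)[OF up[OF tL] tR[folded Q_def]] scale[OF di]])
  then show "(\<lambda>x. tL x + tR x - 2 * (iL x - iR x) * w x) \<in> O[F](\<lambda>x. w x ^ 2)"
    unfolding Q_def by (simp add: algebra_simps)
  have "(\<lambda>x. w' x * iL' x) \<in> Q 1" by (rule mult[OF w'Q Q0[OF bounded(2)]]) simp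
  then have "(\<lambda>x. \<bar>w' x * iL' x\<bar>) \<in> Q 1" by (simp add: Q_def)
  then have e1: "(\<lambda>x. \<bar>w' x * iL' x\<bar> * norm (eL' x - eL x)) \<in> Q 2"
    by (rule mult[OF _ Q1[OF eL']]) simp
  have "(\<lambda>x. \<bar>w' x * iL' x - w x * iL x\<bar>) \<in> Q 2" using di by (simp add: Q_def)
  then have e2: "(\<lambda>x. \<bar>w' x * iL' x - w x * iL x\<bar> * norm (eL x)) \<in> Q 2"
    by (rule mult[OF _ Q0[OF bounded(5)]]) simp
  have bnd: "(\<lambda>x. norm (z x - y x - (2 * w' x * iL' x) *\<^sub>R eL' x)
      + norm (y x - p x + (2 * w x * iR x) *\<^sub>R eR x)
      + 2 * (\<bar>w' x * iL' x\<bar> * norm (eL' x - eL x))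
      + 2 * (\<bar>w' x * iL' x - w x * iL x\<bar> * norm (eL x))) \<in> Q 2" (is "?B \<in> _")
    by (rule add(1)[OF add(1)[OF add(1)[OF up[OF z] y[folded Q_def]] scale[OF e1]] scale[OF e2]])
  show "(\<lambda>x. norm (z x - (p x + (2 * w x) *\<^sub>R (iL x *\<^sub>R eL x - iR x *\<^sub>R eR x)))) \<in> O[F](\<lambda>x. w x ^ 2)"
  proof (rule bigo_norm_bound[OF bnd[unfolded Q_def]])
    fix x
    \<comment> \<open>Exact decomposition into the errors of the two passages, the change of the
      field, and the change of its coefficient between \<open>y\<close> and
      \<open>p\<close>.\<close>
    have split: "z x - (p x + (2 * w x) *\<^sub>R (iL x *\<^sub>R eL x - iR x *\<^sub>R eR x))
      = (z x - y x - (2 * w' x * iL' x) *\<^sub>R eL' x) + (y x - p x + (2 * w x * iR x) *\<^sub>R eR x)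
      + 2 *\<^sub>R ((w' x * iL' x) *\<^sub>R (eL' x - eL x)) + 2 *\<^sub>R ((w' x * iL' x - w x * iL x) *\<^sub>R eL x)"
      by (simp add: algebra_simps)
    have "norm (z x - (p x + (2 * w x) *\<^sub>R (iL x *\<^sub>R eL x - iR x *\<^sub>R eR x))) \<le> ?B x"
      unfolding split
      by (intro norm_triangle_mono order_refl)
        (simp_all only: norm_scaleR abs_mult abs_numeral mult.assoc order_refl)
    then show "\<bar>norm (z x - (p x + (2 * w x) *\<^sub>R (iL x *\<^sub>R eL x - iR x *\<^sub>R eR x)))\<bar> \<le> \<bar>?B x\<bar>"
      unfolding abs_norm_cancel by (rule order_trans[OF _ abs_ge_self])
  qed
  \<comment> \<open>This is \<open>bL' * iL'\<^sup>2 - bL * iL\<^sup>2\<close>, written so that each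
    summand has a factor of order \<open>w\<close>.\<close>
  have dq: "(\<lambda>x. (bL' x - bL x) * (iL' x * iL' x) + bL x * ((iL' x - iL x) * (iL' x + iL x))) \<in> Q 1"
    by (rule add(1)[OF mult[OF Q1[OF bL'] mult[OF Q0[OF bounded(2)] Q0[OF bounded(2)] refl]]
          mult[OF Q0[OF bounded(3)] mult[OF Q1[OF iL'] add(1)[OF Q0[OF bounded(2)] Q0[OF bounded(1)]] refl]]])
      simp_all
  have dw2: "(\<lambda>x. (w' x - w x) * (w' x + w x)) \<in> Q 3"
    by (rule mult[OF dw add(1)[OF w'Q wQ]]) simp
  have v1: "(\<lambda>x. ((bL' x - bL x) * (iL' x * iL' x) + bL x * ((iL' x - iL x) * (iL' x + iL x))) * (w' x * w' x)) \<in> Q 3"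
    by (rule mult[OF dq mult[OF w'Q w'Q refl]]) simp
  have v2: "(\<lambda>x. bL x * (iL x * iL x) * ((w' x - w x) * (w' x + w x))) \<in> Q 3"
    by (rule mult[OF mult[OF Q0[OF bounded(3)] mult[OF Q0[OF bounded(1)] Q0[OF bounded(1)] refl] refl] dw2]) simp
  \<comment> \<open>The first passage contributes \<open>- bR * iR\<^sup>2\<close> through
    \<open>w'\<close>, the second \<open>bL * iL\<^sup>2\<close>; together they form
    \<open>Lambda\<close>.\<close>
  have "(\<lambda>x. (v x - w' x - 2 / 3 * (bL' x * (iL' x)\<^sup>2) * (w' x)\<^sup>2)
      + (w' x - w x + 2 / 3 * (bR x * (iR x)\<^sup>2) * (w x)\<^sup>2)
      + 2 / 3 * (((bL' x - bL x) * (iL' x * iL' x) + bL x * ((iL' x - iL x) * (iL' x + iL x))) * (w' x * w' x)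
        + bL x * (iL x * iL x) * ((w' x - w x) * (w' x + w x)))) \<in> Q 3"
    by (rule add(1)[OF add(1)[OF up[OF v] w'[folded Q_def]] scale[OF add(1)[OF v1 v2]]])
  then show "(\<lambda>x. v x - (w x + 2 / 3 * (bL x * (iL x)\<^sup>2 - bR x * (iR x)\<^sup>2) * (w x)\<^sup>2)) \<in> O[F](\<lambda>x. w x ^ 3)"
    unfolding Q_def by (simp add: algebra_simps power2_eq_square)
qed

lemma first_return_uminus:
  "first_return \<Omega> (\<lambda>x. - H x) f x T y \<longleftrightarrow> first_return \<Omega> H f x T y"
  by (simp add: first_return_def disc_surface_def)

lemma bigo_principalI:
  fixes f g :: "'x \<Rightarrow> real"
  assumes "\<And>x. x \<in> D \<Longrightarrow> \<bar>f x\<bar> \<le> C * \<bar>g x\<bar>"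
  shows "f \<in> O[principal D](g)"
  unfolding bigo_principal_iff using assms by blast

theorem theorem4p1:
  fixes \<Omega> S :: "(real ^ 'n) set"
    and fL fR :: "real ^ 'n \<Rightarrow> real ^ 'n"
    and H :: "real ^ 'n \<Rightarrow> real"
  assumes "piecewise_Ck 3 \<Omega> fL fR H"
    and "refracting \<Omega> fL fR H"
    and "compact S"
    and "invisible_invisible \<Omega> fL fR H S"
  shows "\<exists>N. open N \<and> S \<subseteq> N \<and> N \<subseteq> \<Omega> \<and>
    (\<forall>x \<in> N \<inter> disc_surface \<Omega> H. vel fL H x > 0 \<longrightarrow>
       x \<in> dom_P \<Omega> fL fR H \<and> lie fL 2 H x \<noteq> 0 \<and> lie fR 2 H x \<noteq> 0) \<and>
    (\<exists>C. \<forall>x \<in> N \<inter> disc_surface \<Omega> H. \<forall>\<nu>>0. vel fL H x = \<nu> \<longrightarrow>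
       \<bar>tau \<Omega> fL fR H x - 2 * (1 / lie fL 2 H x - 1 / lie fR 2 H x) * \<nu>\<bar> \<le> C * \<nu>\<^sup>2) \<and>
    (\<exists>C. \<forall>x \<in> N \<inter> disc_surface \<Omega> H. \<forall>\<nu>>0. vel fL H x = \<nu> \<longrightarrow>
       norm (P_map \<Omega> fL fR H x -
         (x + (2 * \<nu>) *\<^sub>R ((1 / lie fL 2 H x) *\<^sub>R fL x - (1 / lie fR 2 H x) *\<^sub>R fR x)))
       \<le> C * \<nu>\<^sup>2) \<and>
    (\<exists>C. \<forall>x \<in> N \<inter> disc_surface \<Omega> H. \<forall>\<nu>>0. vel fL H x = \<nu> \<longrightarrow>
       \<bar>vel fL H (P_map \<Omega> fL fR H x) - (\<nu> + 2 * Lambda fL fR H x * \<nu>\<^sup>2 / 3)\<bar> \<le> C * \<nu> ^ 3)"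
proof -
  have "open \<Omega>" and fL: "Ck_on 3 fL \<Omega>" and fR: "Ck_on 3 fR \<Omega>" and H: "Ck_on (Suc 3) H \<Omega>"
    using assms(1) unfolding piecewise_Ck_def by blast+
  have G: "Ck_on (Suc 3) (\<lambda>x. - H x) \<Omega>" by (rule Ck_on_uminus[OF \<open>open \<Omega>\<close> H])
  have lie_G: "lie fL m (\<lambda>x. - H x) x = - lie fL m H x" if "m \<le> Suc 3" "x \<in> \<Omega>" for m x
    by (rule lie_uminus[OF \<open>open \<Omega>\<close> H fL that])
  define V where "V = lie fL 1 H"
  define aL bL aR bR where "aL = lie fL 2 H" and "bL = lie fL 3 H"
    and "aR = lie fR 2 H" and "bR = lie fR 3 H"
  have refr: "lie fR 1 H x = V x" if "x \<in> disc_surface \<Omega> H" for x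
    using assms(2) that unfolding refracting_def V_def by metis
  have SV: "S \<subseteq> \<Omega>" "\<And>x. x \<in> S \<Longrightarrow> x \<in> disc_surface \<Omega> H" "\<And>x. x \<in> S \<Longrightarrow> V x = 0"
    "\<And>x. x \<in> S \<Longrightarrow> aL x > 0" "\<And>x. x \<in> S \<Longrightarrow> aR x < 0"
    using assms(4)
    unfolding invisible_invisible_def tangency_surface_def vel_def disc_surface_def V_def aL_def aR_def
    by blast+
  have "lie fR 1 H x = 0" "lie fR 2 H x < 0" if "x \<in> S" for x
    using refr[OF SV(2)[OF that]] SV(3,5)[OF that] unfolding aR_def by (simp_all only:)
  then obtain NR CR where NR: "open NR" "S \<subseteq> NR" "NR \<subseteq> \<Omega>" "CR \<ge> 0"
    "\<forall>x\<in>NR. lie fR 2 H x < 0"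
    "\<forall>x\<in>NR. H x = 0 \<longrightarrow> lie fR 1 H x > 0 \<longrightarrow> return_bounds \<Omega> H fR CR x"
    using return_asymptotics[OF \<open>open \<Omega>\<close> H fR \<open>compact S\<close> SV(1)] by metis
  have lG: "lie fL 1 (\<lambda>x. - H x) x = - V x" "lie fL 2 (\<lambda>x. - H x) x = - aL x"
    "lie fL 3 (\<lambda>x. - H x) x = - bL x" if "x \<in> \<Omega>" for x
    unfolding V_def aL_def bL_def by (rule lie_G[OF _ that]; simp)+
  have "lie fL 1 (\<lambda>x. - H x) x = 0" "lie fL 2 (\<lambda>x. - H x) x < 0" if "x \<in> S" for x
    unfolding lG[OF subsetD[OF SV(1) that]] using SV(3,4)[OF that] by simp_all
  then obtain NL CL where NL: "open NL" "S \<subseteq> NL" "NL \<subseteq> \<Omega>" "CL \<ge> 0"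
    "\<forall>x\<in>NL. lie fL 2 (\<lambda>x. - H x) x < 0"
    "\<forall>x\<in>NL. - H x = 0 \<longrightarrow> lie fL 1 (\<lambda>x. - H x) x > 0 \<longrightarrow> return_bounds \<Omega> (\<lambda>x. - H x) fL CL x"
    using return_asymptotics[OF \<open>open \<Omega>\<close> G fL \<open>compact S\<close> SV(1)] by metis
  have RR: "returns \<Omega> H fR x" "return_point \<Omega> H fR x \<in> disc_surface \<Omega> H"
      "norm (return_point \<Omega> H fR x - x) \<le> CR * V x"
      "\<bar>return_time \<Omega> H fR x + 2 * V x * (1 / aR x)\<bar> \<le> CR * (V x)\<^sup>2"
      "norm (return_point \<Omega> H fR x - x + (2 * V x * (1 / aR x)) *\<^sub>R fR x) \<le> CR * (V x)\<^sup>2"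
      "\<bar>V (return_point \<Omega> H fR x) + V x - 2 / 3 * (bR x * (1 / aR x)\<^sup>2) * (V x)\<^sup>2\<bar> \<le> CR * V x ^ 3"
    if x: "x \<in> NR" "x \<in> disc_surface \<Omega> H" "V x > 0" for x
  proof -
    have "H x = 0" using x(2) by (simp add: disc_surface_def)
    moreover have "lie fR 1 H x > 0" using x(3) unfolding refr[OF x(2)] .
    ultimately have B: "return_bounds \<Omega> H fR CR x" using NR(6) x(1) by blast
    have eq: "2 * bR x * (V x)\<^sup>2 / (3 * (aR x)\<^sup>2) = 2 / 3 * (bR x * (1 / aR x)\<^sup>2) * (V x)\<^sup>2"
      "2 * V x / aR x = 2 * V x * (1 / aR x)"
      by (simp_all add: power_divide)
    note B' = B[unfolded return_bounds_def Let_def, unfolded refr[OF x(2)], folded aR_def bR_def,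
        unfolded eq]
    then show *: "returns \<Omega> H fR x" "return_point \<Omega> H fR x \<in> disc_surface \<Omega> H"
      "norm (return_point \<Omega> H fR x - x) \<le> CR * V x"
      "\<bar>return_time \<Omega> H fR x + 2 * V x * (1 / aR x)\<bar> \<le> CR * (V x)\<^sup>2"
      "norm (return_point \<Omega> H fR x - x + (2 * V x * (1 / aR x)) *\<^sub>R fR x) \<le> CR * (V x)\<^sup>2"
      by blast+
    \<comment> \<open>The return point is again on the surface, where refraction identifies the
      velocity under \<open>fR\<close> with \<open>V\<close>.\<close>
    show "\<bar>V (return_point \<Omega> H fR x) + V x - 2 / 3 * (bR x * (1 / aR x)\<^sup>2) * (V x)\<^sup>2\<bar> \<le> CR * V x ^ 3"
      using B' unfolding refr[OF *(2)] by blast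
  qed
  have RL: "returns \<Omega> H fL x" "return_point \<Omega> H fL x \<in> disc_surface \<Omega> H"
      "\<bar>return_time \<Omega> H fL x - 2 * - V x * (1 / aL x)\<bar> \<le> CL * (- V x)\<^sup>2"
      "norm (return_point \<Omega> H fL x - x - (2 * - V x * (1 / aL x)) *\<^sub>R fL x) \<le> CL * (- V x)\<^sup>2"
      "\<bar>V (return_point \<Omega> H fL x) - - V x - 2 / 3 * (bL x * (1 / aL x)\<^sup>2) * (- V x)\<^sup>2\<bar>
        \<le> CL * (- V x) ^ 3"
    if x: "x \<in> NL" "x \<in> disc_surface \<Omega> H" "V x < 0" for x
  proof -
    let ?y = "return_point \<Omega> H fL x"
    have "x \<in> \<Omega>" using x(1) NL(3) by blast
    have uminus: "return_time \<Omega> (\<lambda>x. - H x) fL = return_time \<Omega> H fL"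
      "return_point \<Omega> (\<lambda>x. - H x) fL = return_point \<Omega> H fL"
      "returns \<Omega> (\<lambda>x. - H x) fL = returns \<Omega> H fL"
      "disc_surface \<Omega> (\<lambda>x. - H x) = disc_surface \<Omega> H"
      by (simp_all add: fun_eq_iff return_time_def return_point_def returns_def first_return_uminus
          disc_surface_def)
    have "- H x = 0" using x(2) by (simp add: disc_surface_def)
    moreover have "lie fL 1 (\<lambda>x. - H x) x > 0" unfolding lG[OF \<open>x \<in> \<Omega>\<close>] using x(3) by simp
    ultimately have B: "return_bounds \<Omega> (\<lambda>x. - H x) fL CL x" using NL(6) x(1) by blast
    have eq: "2 * - V x / - aL x = - (2 * - V x * (1 / aL x))" by simp
    note B' = B[unfolded return_bounds_def Let_def, unfolded uminus lG[OF \<open>x \<in> \<Omega>\<close>] eq]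
    then have B1: "returns \<Omega> H fL x" "?y \<in> disc_surface \<Omega> H"
      "\<bar>return_time \<Omega> H fL x + - (2 * - V x * (1 / aL x))\<bar> \<le> CL * (- V x)\<^sup>2"
      "norm (?y - x + (- (2 * - V x * (1 / aL x))) *\<^sub>R fL x) \<le> CL * (- V x)\<^sup>2"
      by blast+
    then show "returns \<Omega> H fL x" "?y \<in> disc_surface \<Omega> H"
      "\<bar>return_time \<Omega> H fL x - 2 * - V x * (1 / aL x)\<bar> \<le> CL * (- V x)\<^sup>2"
      "norm (?y - x - (2 * - V x * (1 / aL x)) *\<^sub>R fL x) \<le> CL * (- V x)\<^sup>2"
      by simp_all
    have "?y \<in> \<Omega>" using B1(2) by (simp add: disc_surface_def)
    \<comment> \<open>Both velocities and the third derivative change sign with \<open>H\<close>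
      while the square of the second does not, so the velocity law is the same on both sides. The
      opposite signs in \<open>Lambda\<close> come from composing two reversals.\<close>
    have "- V ?y + - V x - 2 * - bL x * (- V x)\<^sup>2 / (3 * (- aL x)\<^sup>2)
        = - (V ?y - - V x - 2 / 3 * (bL x * (1 / aL x)\<^sup>2) * (- V x)\<^sup>2)"
      by (simp add: power_divide)
    then show "\<bar>V ?y - - V x - 2 / 3 * (bL x * (1 / aL x)\<^sup>2) * (- V x)\<^sup>2\<bar> \<le> CL * (- V x) ^ 3"
      using B' unfolding lG[OF \<open>?y \<in> \<Omega>\<close>] by (metis abs_minus_cancel)
  qed
  \<comment> \<open>A new compact neighbourhood inside both domains: the intermediate point must
    land in \<open>NL\<close>.\<close>
  obtain r where r: "r > 0" "compact (\<Union>x\<in>S. cball x (2 * r))"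
      "(\<Union>x\<in>S. cball x (2 * r)) \<subseteq> NL \<inter> NR"
      "\<And>s x. s \<in> S \<Longrightarrow> x \<in> ball s r \<Longrightarrow> cball x r \<subseteq> (\<Union>x\<in>S. cball x (2 * r))"
    by (rule compact_cball_neighbourhood[OF \<open>compact S\<close> open_Int[OF NL(1) NR(1)]])
      (use NL(2) NR(2) in auto)
  define K where "K = (\<Union>x\<in>S. cball x (2 * r))"
  have K: "compact K" "K \<subseteq> NL" "K \<subseteq> NR" "K \<subseteq> \<Omega>" using r NL(3) by (auto simp: K_def)
  have aL_pos: "aL x > 0" if "x \<in> K" for x
    using NL(5) lG(2)[of x] that K by force
  have aR_neg: "aR x < 0" if "x \<in> K" for x
    using NR(5) that K by (auto simp: aR_def)
  have CkL: "Ck_on (Suc 3 - m) (lie fL m H) \<Omega>" and CkR: "Ck_on (Suc 3 - m) (lie fR m H) \<Omega>"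
    if "m \<le> Suc 3" for m
    using Ck_on_lie[OF \<open>open \<Omega>\<close> H fL that] Ck_on_lie[OF \<open>open \<Omega>\<close> H fR that] .
  \<comment> \<open>Coefficients of the second passage are moved from the intermediate point to
    \<open>x\<close>, so those of \<open>fL\<close> get Lipschitz constants; those of
    \<open>fR\<close> already sit at \<open>x\<close>.\<close>
  have "Ck_on (Suc 0) aL \<Omega>" unfolding aL_def by (rule Ck_on_le[OF CkL[of 2]]) simp_all
  moreover have "Ck_on (Suc 0) bL \<Omega>" unfolding bL_def by (rule Ck_on_le[OF CkL[of 3]]) simp_all
  moreover have "Ck_on (Suc 0) fL \<Omega>" by (rule Ck_on_le[OF fL]) simp
  ultimately obtain La Lb Lf where lip:
    "\<And>x y. closed_segment x y \<subseteq> K \<Longrightarrow> norm (aL x - aL y) \<le> La * norm (x - y)"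
    "\<And>x y. closed_segment x y \<subseteq> K \<Longrightarrow> norm (bL x - bL y) \<le> Lb * norm (x - y)"
    "\<And>x y. closed_segment x y \<subseteq> K \<Longrightarrow> norm (fL x - fL y) \<le> Lf * norm (x - y)"
    and Lpos: "La \<ge> 0" "Lb \<ge> 0" "Lf \<ge> 0"
    using C1_lipschitz_on_compact[OF _ K(1,4)] by metis
  have cont: "continuous_on K aL" "continuous_on K bL" "continuous_on K aR" "continuous_on K bR"
      "continuous_on K fL"
    unfolding aL_def bL_def aR_def bR_def
    by (rule continuous_on_subset[OF Ck_on_imp_continuous_on[OF CkL] K(4)]
        continuous_on_subset[OF Ck_on_imp_continuous_on[OF CkR] K(4)]
        continuous_on_subset[OF Ck_on_imp_continuous_on[OF fL] K(4)]; simp)+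
  have nz: "\<forall>x\<in>K. aL x \<noteq> 0" "\<forall>x\<in>K. aR x \<noteq> 0" using aL_pos aR_neg by force+
  have ci: "continuous_on K (\<lambda>x. 1 / aL x)" "continuous_on K (\<lambda>x. bR x * (1 / aR x)\<^sup>2)"
    using nz by (auto intro!: continuous_intros cont)
  obtain Bi where Bi: "\<And>x. x \<in> K \<Longrightarrow> norm (1 / aL x) \<le> Bi" "Bi > 0"
    using compact_bounded_image[OF K(1) ci(1)] by auto
  obtain q where q: "\<And>x. x \<in> K \<Longrightarrow> norm (bR x * (1 / aR x)\<^sup>2) \<le> q" "q > 0"
    using compact_bounded_image[OF K(1) ci(2)] by auto
  obtain Bb where Bb: "\<And>x. x \<in> K \<Longrightarrow> norm (bL x) \<le> Bb"
    using compact_bounded_image[OF K(1) cont(2)] by auto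
  obtain Bf where Bf: "\<And>x. x \<in> K \<Longrightarrow> norm (fL x) \<le> Bf"
    using compact_bounded_image[OF K(1) cont(5)] by auto
  \<comment> \<open>With \<open>V x < \<epsilon>\<close>, cubes lie below squares, the intermediate
    point is within \<open>r\<close> of \<open>x\<close>, and the velocity there is negative, as the
    domain of \<open>P\<^sub>L\<close> requires. The \<open>+ 1\<close> covers \<open>CR = 0\<close>
    and supplies strictness.\<close>
  define \<epsilon> where "\<epsilon> = min 1 (min (r / (CR + 1)) (1 / (q + CR + 1)))"
  have \<epsilon>: "\<epsilon> > 0" "\<epsilon> \<le> 1" "(CR + 1) * \<epsilon> \<le> r" "(q + CR + 1) * \<epsilon> \<le> 1"
  proof -
    show "\<epsilon> > 0" "\<epsilon> \<le> 1" using r(1) q(2) NR(4) by (simp_all add: \<epsilon>_def)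
    have "\<epsilon> \<le> r / (CR + 1)" "\<epsilon> \<le> 1 / (q + CR + 1)" by (simp_all add: \<epsilon>_def)
    then show "(CR + 1) * \<epsilon> \<le> r" "(q + CR + 1) * \<epsilon> \<le> 1"
      using q(2) NR(4) by (simp_all add: field_simps)
  qed
  define N where "N = (\<Union>s\<in>S. ball s r) \<inter> {x \<in> \<Omega>. V x < \<epsilon>}"
  have "continuous_on \<Omega> V" unfolding V_def by (rule Ck_on_imp_continuous_on[OF CkL]) simp
  then have "open N"
    unfolding N_def by (intro open_Int open_UN ballI open_ball open_Collect_less_on \<open>open \<Omega>\<close>)
  have "N \<subseteq> \<Omega>" by (auto simp: N_def)
  have "S \<subseteq> N"
  proof
    fix s assume "s \<in> S"
    then show "s \<in> N" using SV(1) SV(3)[of s] \<epsilon>(1) r(1) unfolding N_def by (auto intro!: bexI[of _ s])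
  qed
  have NK: "cball x r \<subseteq> K" "x \<in> K" if "x \<in> N" for x
  proof -
    show "cball x r \<subseteq> K" using r(4) that by (auto simp: N_def K_def)
    then show "x \<in> K" using r(1) by auto
  qed
  define D where "D = {x \<in> N \<inter> disc_surface \<Omega> H. V x > 0}"
  define Y where "Y = return_point \<Omega> H fR"
  define Z where "Z = (\<lambda>x. return_point \<Omega> H fL (Y x))"
  have D: "x \<in> NR" "x \<in> K" "x \<in> disc_surface \<Omega> H" "V x > 0" "V x < \<epsilon>" if "x \<in> D" for x
    using that NK(2) K(3) by (auto simp: D_def N_def)
  have R: "returns \<Omega> H fR x" "Y x \<in> disc_surface \<Omega> H" "norm (Y x - x) \<le> CR * V x"
      "\<bar>return_time \<Omega> H fR x + 2 * V x * (1 / aR x)\<bar> \<le> CR * (V x)\<^sup>2"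
      "norm (Y x - x + (2 * V x * (1 / aR x)) *\<^sub>R fR x) \<le> CR * (V x)\<^sup>2"
      "\<bar>V (Y x) + V x - 2 / 3 * (bR x * (1 / aR x)\<^sup>2) * (V x)\<^sup>2\<bar> \<le> CR * V x ^ 3" if "x \<in> D" for x
    using RR[OF D(1,3,4)[OF that]] unfolding Y_def .
  have YK: "closed_segment (Y x) x \<subseteq> K" "Y x \<in> K" if "x \<in> D" for x
  proof -
    have "CR * V x \<le> CR * \<epsilon>" using D(5)[OF that] NR(4) by (intro mult_left_mono) auto
    also have "\<dots> \<le> r" using \<epsilon>(1,3) by (simp add: distrib_right)
    finally have "Y x \<in> cball x r"
      using R(3)[OF that] by (simp add: dist_norm norm_minus_commute)
    then have "closed_segment (Y x) x \<subseteq> cball x r"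
      using r(1) by (intro closed_segment_subset) auto
    then show "closed_segment (Y x) x \<subseteq> K" using NK(1)[of x] that by (auto simp: D_def)
    then show "Y x \<in> K" by auto
  qed
  \<comment> \<open>The passage estimate gives
    \<open>V (Y x) \<le> - V x + q * (V x)\<^sup>2 + CR * V x ^ 3\<close>, and the choice of
    \<open>\<epsilon>\<close> lets the linear term win.\<close>
  have VY: "V (Y x) < 0" if "x \<in> D" for x
  proof -
    note Vx = D(4,5)[OF that]
    have "2 / 3 * (bR x * (1 / aR x)\<^sup>2) * (V x)\<^sup>2 \<le> q * (V x)\<^sup>2"
    proof (rule mult_right_mono)
      show "2 / 3 * (bR x * (1 / aR x)\<^sup>2) \<le> q"
        using q(1)[OF D(2)[OF that]] q(2) unfolding real_norm_def by linarith
    qed simp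
    moreover have "CR * V x ^ 3 \<le> CR * (V x)\<^sup>2"
      using Vx \<epsilon>(2) NR(4) by (intro mult_left_mono power_decreasing) auto
    moreover have "((q + CR) * V x) * V x < 1 * V x"
    proof (rule mult_strict_right_mono)
      have "(q + CR) * V x \<le> (q + CR) * \<epsilon>" using Vx q(2) NR(4) by (intro mult_left_mono) auto
      also have "\<dots> < 1" using \<epsilon>(1,4) by (simp add: algebra_simps)
      finally show "(q + CR) * V x < 1" .
    qed (rule Vx)
    then have "q * (V x)\<^sup>2 + CR * (V x)\<^sup>2 < V x" by (simp add: power2_eq_square algebra_simps)
    ultimately show ?thesis using R(6)[OF that] by linarith
  qed
  have L: "returns \<Omega> H fL (Y x)"
      "\<bar>return_time \<Omega> H fL (Y x) - 2 * - V (Y x) * (1 / aL (Y x))\<bar> \<le> CL * (- V (Y x))\<^sup>2"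
      "norm (Z x - Y x - (2 * - V (Y x) * (1 / aL (Y x))) *\<^sub>R fL (Y x)) \<le> CL * (- V (Y x))\<^sup>2"
      "\<bar>V (Z x) - - V (Y x) - 2 / 3 * (bL (Y x) * (1 / aL (Y x))\<^sup>2) * (- V (Y x))\<^sup>2\<bar>
        \<le> CL * (- V (Y x)) ^ 3" if "x \<in> D" for x
    using RL(1,3-5)[OF subsetD[OF K(2) YK(2)[OF that]] R(2)[OF that] VY[OF that]]
    unfolding Z_def .
  \<comment> \<open>A Lipschitz quantity changes by order \<open>V\<close> between \<open>x\<close>
    and \<open>Y x\<close>, because the displacement has that order.\<close>
  have lipY: "g \<in> O[principal D](V)" if "\<And>x. x \<in> D \<Longrightarrow> \<bar>g x\<bar> \<le> c * norm (Y x - x)" "c \<ge> 0" for g c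
  proof (rule bigo_principalI)
    fix x assume x: "x \<in> D"
    have "\<bar>g x\<bar> \<le> c * (CR * V x)"
      by (rule order_trans[OF that(1)[OF x] mult_left_mono[OF R(3)[OF x] that(2)]])
    then show "\<bar>g x\<bar> \<le> (c * CR) * \<bar>V x\<bar>" using D(4)[OF x] by (simp add: mult.assoc)
  qed
  have O1: "V \<in> O[principal D](\<lambda>_. 1)"
    using D(4,5) \<epsilon>(2) by (intro bigo_principalI[of _ _ 1]) fastforce
  have O2: "(\<lambda>x. 1 / aL x) \<in> O[principal D](\<lambda>_. 1)"
    using Bi(1)[OF D(2)] by (intro bigo_principalI[of _ _ Bi]) simp
  have O3: "(\<lambda>x. 1 / aL (Y x)) \<in> O[principal D](\<lambda>_. 1)"
    using Bi(1)[OF YK(2)] by (intro bigo_principalI[of _ _ Bi]) simp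
  have O4: "bL \<in> O[principal D](\<lambda>_. 1)"
    using Bb[OF D(2)] by (intro bigo_principalI[of _ _ Bb]) simp
  have O5: "(\<lambda>x. bR x * (1 / aR x)\<^sup>2) \<in> O[principal D](\<lambda>_. 1)"
    using q(1)[OF D(2)] by (intro bigo_principalI[of _ _ q]) simp
  have O6: "(\<lambda>x. norm (fL x)) \<in> O[principal D](\<lambda>_. 1)"
    using Bf[OF D(2)] by (intro bigo_principalI[of _ _ Bf]) simp
  have O7: "(\<lambda>x. 1 / aL (Y x) - 1 / aL x) \<in> O[principal D](V)"
  proof (rule lipY[of _ "Bi * Bi * La"])
    fix x assume x: "x \<in> D"
    have "1 / aL (Y x) - 1 / aL x = - ((1 / aL (Y x)) * (1 / aL x) * (aL (Y x) - aL x))"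
      using aL_pos[OF D(2)[OF x]] aL_pos[OF YK(2)[OF x]] by (simp add: field_simps)
    then have "\<bar>1 / aL (Y x) - 1 / aL x\<bar> = norm (1 / aL (Y x)) * norm (1 / aL x) * norm (aL (Y x) - aL x)"
      by (simp only: abs_minus_cancel abs_mult real_norm_def)
    also have "\<dots> \<le> Bi * Bi * (La * norm (Y x - x))"
      using Bi(2) by (intro mult_mono Bi(1) D(2) YK x lip(1)) auto
    finally show "\<bar>1 / aL (Y x) - 1 / aL x\<bar> \<le> Bi * Bi * La * norm (Y x - x)"
      by (simp only: mult.assoc)
  qed (use Bi(2) Lpos in simp)
  have O8: "(\<lambda>x. bL (Y x) - bL x) \<in> O[principal D](V)"
    by (rule lipY[OF _ Lpos(2)]) (use lip(2)[OF YK(1)] in simp)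
  have O9: "(\<lambda>x. norm (fL (Y x) - fL x)) \<in> O[principal D](V)"
    by (rule lipY[OF _ Lpos(3)]) (use lip(3)[OF YK(1)] in simp)
  have O10: "(\<lambda>x. return_time \<Omega> H fR x + 2 * V x * (1 / aR x)) \<in> O[principal D](\<lambda>x. V x ^ 2)"
    using R(4) by (intro bigo_principalI[of _ _ CR]) simp
  have O11: "(\<lambda>x. norm (Y x - x + (2 * V x * (1 / aR x)) *\<^sub>R fR x)) \<in> O[principal D](\<lambda>x. V x ^ 2)"
    using R(5) by (intro bigo_principalI[of _ _ CR]) simp
  have O12: "(\<lambda>x. - V (Y x) - V x + 2 / 3 * (bR x * (1 / aR x)\<^sup>2) * (V x)\<^sup>2) \<in> O[principal D](\<lambda>x. V x ^ 3)"
  proof (rule bigo_principalI[of _ _ CR])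
    fix x assume x: "x \<in> D"
    have "- V (Y x) - V x + 2 / 3 * (bR x * (1 / aR x)\<^sup>2) * (V x)\<^sup>2
      = - (V (Y x) + V x - 2 / 3 * (bR x * (1 / aR x)\<^sup>2) * (V x)\<^sup>2)" by simp
    moreover have "V x ^ 3 = \<bar>V x ^ 3\<bar>" using D(4)[OF x] by simp
    ultimately show "\<bar>- V (Y x) - V x + 2 / 3 * (bR x * (1 / aR x)\<^sup>2) * (V x)\<^sup>2\<bar> \<le> CR * \<bar>V x ^ 3\<bar>"
      using R(6)[OF x] by (simp only: abs_minus_cancel)
  qed
  have O13: "(\<lambda>x. return_time \<Omega> H fL (Y x) - 2 * - V (Y x) * (1 / aL (Y x)))
      \<in> O[principal D](\<lambda>x. (- V (Y x)) ^ 2)"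
    using L(2) by (intro bigo_principalI[of _ _ CL]) simp
  have O14: "(\<lambda>x. norm (Z x - Y x - (2 * - V (Y x) * (1 / aL (Y x))) *\<^sub>R fL (Y x)))
      \<in> O[principal D](\<lambda>x. (- V (Y x)) ^ 2)"
    using L(3) by (intro bigo_principalI[of _ _ CL]) simp
  have O15: "(\<lambda>x. V (Z x) - - V (Y x) - 2 / 3 * (bL (Y x) * (1 / aL (Y x))\<^sup>2) * (- V (Y x))\<^sup>2)
      \<in> O[principal D](\<lambda>x. (- V (Y x)) ^ 3)"
  proof (rule bigo_principalI[of _ _ CL])
    fix x assume x: "x \<in> D"
    have "(- V (Y x)) ^ 3 \<ge> 0" using VY[OF x] by (intro zero_le_power) simp
    then show "\<bar>V (Z x) - - V (Y x) - 2 / 3 * (bL (Y x) * (1 / aL (Y x))\<^sup>2) * (- V (Y x))\<^sup>2\<bar>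
        \<le> CL * \<bar>(- V (Y x)) ^ 3\<bar>"
      using L(4)[OF x] by (simp only: abs_of_nonneg)
  qed
  note E = composed_expansion[OF O1 O2 O3 O4 O5 O6 O7 O8 O9 O10 O11 O12 O13 O14 O15]
  have tau: "tau \<Omega> fL fR H x = return_time \<Omega> H fL (Y x) + return_time \<Omega> H fR x"
    and P: "P_map \<Omega> fL fR H x = Z x"
    and Lam: "2 * Lambda fL fR H x * t / 3 = 2 / 3 * (bL x * (1 / aL x)\<^sup>2 - bR x * (1 / aR x)\<^sup>2) * t" for x t
    by (simp_all add: tau_def P_map_def Lambda_def Y_def Z_def aL_def bL_def aR_def bR_def power_divide)
  have abs_V: "\<bar>V x ^ m\<bar> = V x ^ m" if "x \<in> D" for x m using D(4)[OF that] by simp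
  \<comment> \<open>The velocity is a separate argument of \<open>g\<close> so that the conclusion
    matches the quantification over \<open>\<nu>\<close> in the theorem.\<close>
  have bound: "\<exists>C. \<forall>x\<in>N \<inter> disc_surface \<Omega> H. \<forall>\<nu>>0. V x = \<nu> \<longrightarrow> g x \<nu> \<le> C * \<nu> ^ m"
    if g: "(\<lambda>x. g x (V x)) \<in> O[principal D](\<lambda>x. V x ^ m)" for g m
  proof -
    obtain C where C: "\<forall>x\<in>D. \<bar>g x (V x)\<bar> \<le> C * \<bar>V x ^ m\<bar>"
      using g unfolding bigo_principal_iff by blast
    have "g x (V x) \<le> C * V x ^ m" if "x \<in> D" for x
    proof -
      have "\<bar>g x (V x)\<bar> \<le> C * \<bar>V x ^ m\<bar>" using C that by blast
      then show ?thesis unfolding abs_V[OF that] by linarith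
    qed
    then show ?thesis unfolding D_def by blast
  qed
  have dom: "\<forall>x\<in>N \<inter> disc_surface \<Omega> H. V x > 0 \<longrightarrow> x \<in> dom_P \<Omega> fL fR H \<and> aL x \<noteq> 0 \<and> aR x \<noteq> 0"
  proof (intro ballI impI)
    fix x assume "x \<in> N \<inter> disc_surface \<Omega> H" "V x > 0"
    then have x: "x \<in> D" by (simp add: D_def)
    have "x \<in> dom_P \<Omega> fL fR H"
      unfolding dom_P_def dom_PR_def dom_PL_def vel_def V_def[symmetric] Y_def[symmetric]
      using R(1,2)[OF x] L(1)[OF x] VY[OF x] D(3,4)[OF x] by blast
    then show "x \<in> dom_P \<Omega> fL fR H \<and> aL x \<noteq> 0 \<and> aR x \<noteq> 0" using nz D(2)[OF x] by blast
  qed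
  \<comment> \<open>The time and velocity estimates concern absolute values, hence
    \<open>bigo_norm_bound\<close>; the estimate for the point is already one of a norm.\<close>
  show ?thesis
    unfolding vel_def V_def[symmetric] aL_def[symmetric] aR_def[symmetric] tau P Lam
    by (intro exI[of _ N] conjI \<open>open N\<close> \<open>S \<subseteq> N\<close> \<open>N \<subseteq> \<Omega>\<close> dom; rule bound,
        rule E(2) bigo_norm_bound[OF E(1)] bigo_norm_bound[OF E(3)]; simp only: abs_abs order_refl)
qed

end
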